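(* The commutation relations between $\mathscr F$, $\mathscr Z$, $\mathscr Z^*$ and the operators $\frac{\partial_R}{\partial\boldsymbol z},\frac{\partial_L}{\partial\boldsymbol z},\frac{\partial_L}{\partial\overline{\boldsymbol z}},\frac{\partial_R}{\partial\overline{\boldsymbol z}}$ are the following: $$\mathscr Z\circ\mathscr F=(q^{-2}-1)\,\mathscr F\circ\frac{\partial_R}{\partial\boldsymbol z},\qquad \mathscr Z^*\circ\mathscr F=-(q^2-q^4)\,\mathscr F\circ\frac{\partial_R}{\partial\overline{\boldsymbol z}},$$ $$\frac{\partial_L}{\partial\boldsymbol z}\circ\mathscr F=-\frac1{1-q^2}\,\mathscr F\circ\mathscr Z,\qquad \frac{\partial_L}{\partial\overline{\boldsymbol z}}\circ\mathscr F=\frac1{1-q^2}\,\mathscr F\circ\mathscr Z^*,$$ $$\frac{\partial_R}{\partial\boldsymbol z}\circ\mathscr F=-\frac{q^4}{1-q^2}\,\mathscr F\circ\mathscr Z\circ(\sigma_i\circ\theta),\qquad \frac{\partial_R}{\partial\overline{\boldsymbol z}}\circ\mathscr F=\frac{q^4}{1-q^2}\,\mathscr F\circ\mathscr Z^*\circ(\sigma_i\circ\theta^{-1}).$$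
   Context: Fix $0<q<1$; $\Gamma=\{z\in\mathbb C:|z|\in q^{\mathbb Z}\}$, $\overline\Gamma=\Gamma\cup\{0\}$. For a function $f$ on $\overline\Gamma$, $f(q\cdot z)$ (resp. $f(q^{-1}\cdot z)$) denotes the value at $t=-i$ (resp. $t=i$) of the holomorphic continuation of $\mathbb R\ni t\mapsto f(q^{it}z)$, when it exists. Expressions such as $f(q\cdot q^{-1}z)$ denote the value of $w\mapsto f(q\cdot w)$ at $w=q^{-1}z$, etc. The differential operators are $$\frac{\partial_R f}{\partial\boldsymbol z}=\frac{f(q^{-1}\cdot q^{-1}z)-f(z)}{(q^{-2}-1)z},\quad \frac{\partial_L f}{\partial\boldsymbol z}=\frac{f(z)-f(q\cdot qz)}{(1-q^2)z},$$ $$\frac{\partial_L f}{\partial\overline{\boldsymbol z}}=\frac{f(q\cdot q^{-1}z)-f(z)}{(q^{-2}-1)\overline z},\quad \frac{\partial_R f}{\partial\overline{\boldsymbol z}}=\frac{f(z)-f(q^{-1}\cdot qz)}{(1-q^2)\overline z}$$ (these formulas make sense for $z$ away from $0$). $\mathscr B$ is the algebra of all continuous functions on $\overline\Gamma$ which can be continued analytically from any circle $\{z\in\overline\Gamma:|z|=q^n\}$ to a holomorphic function on $\mathbb C\setminus\{0\}$. $C^\infty_q(\overline\Gamma)$ is the set of $f\in\mathscr B$ such that $\lim_{\Gamma\ni z\to0}Df(z)$ exists for any product $D$ of the four operators above. The measure $\mu$ on $\overline\Gamma$ is given by $\int_{\overline\Gamma}f\,d\mu=\sum_{k\in\mathbb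 Z}\frac{q^{2k}}{2\pi}\int_0^{2\pi}f(q^ke^{i\varphi})\,d\varphi$. The quantum exponential function $F_q$ is the continuous function on $\overline\Gamma$ given by $F_q(z)=\prod_{k=0}^\infty\frac{1+q^{2k}\overline z}{1+q^{2k}z}$ for $z\notin\{-q^{-2k}:k=0,1,2,\dots\}$. For $f\in C^\infty_q(\overline\Gamma)$ integrable with respect to $\mu$, $$(\mathscr Ff)(\zeta)=\int_{\overline\Gamma}F_q(\zeta z)f(z)\,d\mu(z).$$ $\mathscr Z$ is the operator of multiplication by the function $z\mapsto z$ on $\overline\Gamma$ and $\mathscr Z^*$ is multiplication by $z\mapsto\overline z$. For a function $g$ on $\overline\Gamma$ and $t\in\mathbb R$, $(\sigma_t(g))(z)=g(q^{-it}z)$ and $(\theta(g))(z)=g(qz)$; $\sigma_i$ is the analytic generator of the group $(\sigma_t)_{t\in\mathbb R}$ on continuous functions, with domain $\mathscr B$, i.e. $(\sigma_i(g))(z)=g(q\cdot z)$.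
   Formalization: The constant of the last relation is corrected from q^4/(1-q^2) to q^{-4}/(1-q^2); the printed one fails for f equal to 1 on |z|=1 and 0 elsewhere. Each relation is stated for integrable f in C_q^∞ such that the function transformed on the right is also integrable. *)

theory Defs
  imports "HOL-Analysis.Analysis"
begin

text \<open>Functions on \<open>\<Gamma> \<union> {0}\<close> are represented by functions on all of \<open>\<complex>\<close> of which only the
  values on \<open>\<Gamma> \<union> {0}\<close> are ever used.\<close>

definition Gam :: "real \<Rightarrow> complex set" where
  "Gam q = {z. \<exists>n::int. cmod z = q powi n}"

definition Gam_bar :: "real \<Rightarrow> complex set" where
  "Gam_bar q = Gam q \<union> {0}"

text \<open>\<open>continues_to q s f z w\<close>: the map \<open>t \<mapsto> f (q\<^bsup>it\<^esup> z)\<close> on the real line has a holomorphic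
  continuation to the point \<open>t = - i s\<close> (where \<open>q\<^bsup>it\<^esup> = q\<^bsup>s\<^esup>\<close>), with value \<open>w\<close> there. As for the
  analytic generator of a one-parameter group, the continuation is continuous on the closed strip
  between the real line and the line through \<open>- i s\<close>, and holomorphic in its interior.\<close>

definition continues_to ::
    "real \<Rightarrow> real \<Rightarrow> (complex \<Rightarrow> complex) \<Rightarrow> complex \<Rightarrow> complex \<Rightarrow> bool" where
  "continues_to q s f z w \<longleftrightarrow>
     (\<exists>h. continuous_on {t. Im t \<in> closed_segment 0 (- s)} h \<and>
          h holomorphic_on {t. Im t \<in> open_segment 0 (- s)} \<and>
          (\<forall>t::real. h (of_real t) = f (of_real q powr (\<i> * of_real t) * z)) \<and>
          h (- \<i> * of_real s) = w)"

definition continuable :: "real \<Rightarrow> real \<Rightarrow> (complex \<Rightarrow> complex) \<Rightarrow> bool" where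
  "continuable q s f \<longleftrightarrow> (\<forall>z\<in>Gam q. \<exists>w. continues_to q s f z w)"

text \<open>\<open>dot q s f z\<close> is \<open>f (q\<^bsup>s\<^esup> \<cdot> z)\<close>. It is not the value of \<open>f\<close> at the point \<open>q\<^bsup>s\<^esup> z\<close>.\<close>

definition dot :: "real \<Rightarrow> real \<Rightarrow> (complex \<Rightarrow> complex) \<Rightarrow> complex \<Rightarrow> complex" where
  "dot q s f z = (THE w. continues_to q s f z w)"

text \<open>The quotients below make sense for \<open>z \<noteq> 0\<close>; at \<open>0\<close> the derivatives are defined as limits
  along \<open>\<Gamma>\<close>.\<close>

definition extend0 :: "real \<Rightarrow> (complex \<Rightarrow> complex) \<Rightarrow> complex \<Rightarrow> complex" where
  "extend0 q g z = (if z = 0 then Lim (at 0 within Gam q) g else g z)"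

definition dR :: "real \<Rightarrow> (complex \<Rightarrow> complex) \<Rightarrow> complex \<Rightarrow> complex" where
  "dR q f = extend0 q (\<lambda>z. (dot q (-1) f (of_real (inverse q) * z) - f z)
                             / (of_real (q powi (-2) - 1) * z))"

definition dL :: "real \<Rightarrow> (complex \<Rightarrow> complex) \<Rightarrow> complex \<Rightarrow> complex" where
  "dL q f = extend0 q (\<lambda>z. (f z - dot q 1 f (of_real q * z))
                             / (of_real (1 - q ^ 2) * z))"

definition dL_bar :: "real \<Rightarrow> (complex \<Rightarrow> complex) \<Rightarrow> complex \<Rightarrow> complex" where
  "dL_bar q f = extend0 q (\<lambda>z. (dot q 1 f (of_real (inverse q) * z) - f z)
                                 / (of_real (q powi (-2) - 1) * cnj z))"

definition dR_bar :: "real \<Rightarrow> (complex \<Rightarrow> complex) \<Rightarrow> complex \<Rightarrow> complex" where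
  "dR_bar q f = extend0 q (\<lambda>z. (f z - dot q (-1) f (of_real q * z))
                                 / (of_real (1 - q ^ 2) * cnj z))"

definition B_alg :: "real \<Rightarrow> (complex \<Rightarrow> complex) set" where
  "B_alg q = {f. continuous_on (Gam_bar q) f \<and>
                 (\<forall>n::int. \<exists>h. h holomorphic_on (- {0}) \<and>
                               (\<forall>z. cmod z = q powi n \<longrightarrow> h z = f z))}"

definition Cinf :: "real \<Rightarrow> (complex \<Rightarrow> complex) set" where
  "Cinf q = {f \<in> B_alg q. \<forall>Ds. set Ds \<subseteq> {dR q, dL q, dL_bar q, dR_bar q} \<longrightarrow>
                (\<exists>l. (foldr (\<circ>) Ds id f \<longlongrightarrow> l) (at 0 within Gam q))}"

text \<open>The image of \<open>q\<^bsup>2k\<^esup>/(2\<pi>) dk d\<phi>\<close> on \<open>\<int> \<times> [0, 2\<pi>]\<close> under \<open>(k, \<phi>) \<mapsto> q\<^bsup>k\<^esup> e\<^bsup>i\<phi>\<^esup>\<close>.\<close>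

definition mu :: "real \<Rightarrow> complex measure" where
  "mu q = distr
     (density (count_space (UNIV :: int set) \<Otimes>\<^sub>M restrict_space lborel {0..2 * pi})
        (\<lambda>(k, \<phi>). ennreal (q powi (2 * k) / (2 * pi))))
     (restrict_space borel (Gam_bar q))
     (\<lambda>(k, \<phi>). of_real (q powi k) * cis \<phi>)"

lemma nn_integral_mu:
  assumes q: "0 < q" and f: "f \<in> borel_measurable (restrict_space borel (Gam_bar q))"
  shows "(\<integral>\<^sup>+z. f z \<partial>mu q) =
    (\<integral>\<^sup>+k. ennreal (q powi (2 * k) / (2 * pi)) *
       (\<integral>\<^sup>+\<phi>\<in>{0..2 * pi}. f (of_real (q powi k) * cis \<phi>) \<partial>lborel) \<partial>count_space (UNIV :: int set))"
proof -
  let ?N = "restrict_space lborel {0..2 * pi}"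
  let ?M = "count_space (UNIV :: int set) \<Otimes>\<^sub>M ?N"
  let ?T = "\<lambda>(k::int, \<phi>). complex_of_real (q powi k) * cis \<phi>"
  let ?d = "\<lambda>(k::int, \<phi>::real). ennreal (q powi (2 * k) / (2 * pi))"
  have cis: "cis \<in> borel_measurable borel"
    by (intro borel_measurable_continuous_onI continuous_intros)
  have N: "(\<lambda>x. x) \<in> ?N \<rightarrow>\<^sub>M borel" by (simp add: measurable_restrict_space1)
  have T: "?T \<in> ?M \<rightarrow>\<^sub>M restrict_space borel (Gam_bar q)"
  proof (rule measurable_restrict_space2)
    show "?T \<in> space ?M \<rightarrow> Gam_bar q"
      using q by (auto simp: Gam_bar_def Gam_def norm_mult norm_power_int)
    show "?T \<in> borel_measurable ?M"
    proof -
      have "(\<lambda>x. complex_of_real (q powi fst x)) \<in> borel_measurable ?M"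
        by (rule measurable_compose[OF measurable_fst]) simp
      moreover have "(\<lambda>x. cis (snd x)) \<in> borel_measurable ?M"
        by (rule measurable_compose[OF measurable_compose[OF measurable_snd N] cis])
      ultimately show ?thesis
        unfolding case_prod_unfold by (rule borel_measurable_times)
    qed
  qed
  have d: "?d \<in> borel_measurable ?M"
    unfolding case_prod_unfold by (rule measurable_compose[OF measurable_fst]) simp
  interpret N: sigma_finite_measure ?N
    by (rule sigma_finite_measure_restrict_space) (simp_all add: lborel.sigma_finite_measure_axioms)
  have fT: "(\<lambda>x. f (?T x)) \<in> borel_measurable ?M"
    by (rule measurable_compose[OF T f])
  have "(\<integral>\<^sup>+z. f z \<partial>mu q) = (\<integral>\<^sup>+x. f (?T x) \<partial>density ?M ?d)"
    unfolding mu_def by (rule nn_integral_distr) (use T f in \<open>simp_all only: measurable_density_eq1 measurable_distr_eq1\<close>)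
  also have "\<dots> = (\<integral>\<^sup>+x. ?d x * f (?T x) \<partial>?M)"
    by (rule nn_integral_density[OF d fT])
  also have "\<dots> = (\<integral>\<^sup>+k. (\<integral>\<^sup>+\<phi>. ?d (k, \<phi>) * f (?T (k, \<phi>)) \<partial>?N) \<partial>count_space UNIV)"
    by (rule N.nn_integral_fst[symmetric]) (rule borel_measurable_times_ennreal[OF d fT])
  also have "\<dots> = (\<integral>\<^sup>+k. ennreal (q powi (2 * k) / (2 * pi)) *
       (\<integral>\<^sup>+\<phi>\<in>{0..2 * pi}. f (of_real (q powi k) * cis \<phi>) \<partial>lborel) \<partial>count_space UNIV)"
  proof (rule nn_integral_cong)
    fix k
    have "(\<lambda>\<phi>. f (?T (k, \<phi>))) \<in> borel_measurable ?N"
      by (rule measurable_compose[OF measurable_Pair1' fT]) simp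
    then have "(\<integral>\<^sup>+\<phi>. ?d (k, \<phi>) * f (?T (k, \<phi>)) \<partial>?N)
        = ennreal (q powi (2 * k) / (2 * pi)) * (\<integral>\<^sup>+\<phi>. f (?T (k, \<phi>)) \<partial>?N)"
      unfolding prod.case by (rule nn_integral_cmult)
    also have "(\<integral>\<^sup>+\<phi>. f (?T (k, \<phi>)) \<partial>?N)
        = (\<integral>\<^sup>+\<phi>\<in>{0..2 * pi}. f (of_real (q powi k) * cis \<phi>) \<partial>lborel)"
      unfolding prod.case by (rule nn_integral_restrict_space) simp
    finally show "(\<integral>\<^sup>+\<phi>. ?d (k, \<phi>) * f (?T (k, \<phi>)) \<partial>?N) = ennreal (q powi (2 * k) / (2 * pi)) *
        (\<integral>\<^sup>+\<phi>\<in>{0..2 * pi}. f (of_real (q powi k) * cis \<phi>) \<partial>lborel)" .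
  qed
  finally show ?thesis .
qed

text \<open>At the points \<open>- q\<^bsup>-2k\<^esup>\<close>, where a denominator of the product vanishes, the value is
  determined by continuity on \<open>\<Gamma> \<union> {0}\<close>.\<close>

definition Fq :: "real \<Rightarrow> complex \<Rightarrow> complex" where
  "Fq q z =
     (let P = (\<lambda>w. \<Prod>k. (1 + of_real (q ^ (2 * k)) * cnj w) / (1 + of_real (q ^ (2 * k)) * w))
      in if \<exists>k::nat. z = - of_real (q powi (- 2 * int k))
         then Lim (at z within Gam_bar q) P else P z)"

definition Fourier :: "real \<Rightarrow> (complex \<Rightarrow> complex) \<Rightarrow> complex \<Rightarrow> complex" where
  "Fourier q f \<zeta> = (\<integral>z. Fq q (\<zeta> * z) * f z \<partial>mu q)"

definition Zop :: "(complex \<Rightarrow> complex) \<Rightarrow> complex \<Rightarrow> complex" where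
  "Zop f z = z * f z"

definition Zop_star :: "(complex \<Rightarrow> complex) \<Rightarrow> complex \<Rightarrow> complex" where
  "Zop_star f z = cnj z * f z"

definition sigma_i :: "real \<Rightarrow> (complex \<Rightarrow> complex) \<Rightarrow> complex \<Rightarrow> complex" where
  "sigma_i q g = dot q 1 g"

definition theta :: "real \<Rightarrow> (complex \<Rightarrow> complex) \<Rightarrow> complex \<Rightarrow> complex" where
  "theta q g z = g (of_real q * z)"

definition theta_inv :: "real \<Rightarrow> (complex \<Rightarrow> complex) \<Rightarrow> complex \<Rightarrow> complex" where
  "theta_inv q g z = g (of_real (inverse q) * z)"

text \<open>Scaling moves powers of \<open>q\<close> between the two sides: if \<open>g = \<sigma>\<^sub>i (\<theta>\<^sup>-\<^sup>1 f)\<close>, then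
  \<open>(F f)(q\<^sup>-\<^sup>1 \<cdot> q\<zeta>) = q\<^sup>-\<^sup>2 (F g)(\<zeta>)\<close>, whereas for \<open>g = \<sigma>\<^sub>i (\<theta> f)\<close>,
  \<open>(F f)(q\<^sup>-\<^sup>1 \<cdot> q\<^sup>-\<^sup>1\<zeta>) = q\<^sup>2 (F g)(\<zeta>)\<close>. Accordingly the relation between \<open>dR_bar\<close>,
  \<open>Fourier\<close> and \<open>theta_inv\<close> has the constant \<open>q\<^sup>-\<^sup>4/(1 - q\<^sup>2)\<close>, while the one between \<open>dR\<close>,
  \<open>Fourier\<close> and \<open>theta\<close> has \<open>- q\<^sup>4/(1 - q\<^sup>2)\<close>.\<close>

text \<open>\<open>g\<close> is in the domain of a derivative \<open>D\<close> built from \<open>g (q\<^bsup>s\<^esup> \<cdot> z)\<close>: the continuation needed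
  in the quotient exists on all of \<open>\<Gamma>\<close>, and the quotient extends continuously to \<open>0\<close>.\<close>

definition diff_dom ::
    "real \<Rightarrow> real \<Rightarrow> ((complex \<Rightarrow> complex) \<Rightarrow> complex \<Rightarrow> complex) \<Rightarrow> (complex \<Rightarrow> complex) \<Rightarrow> bool" where
  "diff_dom q s D g \<longleftrightarrow> continuable q s g \<and> (\<exists>l. (D g \<longlongrightarrow> l) (at 0 within Gam q))"

end

theory Submission
  imports Defs "HOL-Complex_Analysis.Complex_Analysis"
begin

text \<open>On the circle \<open>|w| = q\<^sup>N\<close> the function \<open>F\<^sub>q\<close> has a continuation \<open>K\<^sub>N\<close> which is holomorphic on a
  punctured disc containing the circle and satisfies \<open>K\<^sub>N(q\<^sup>2 u) = (1 + u) K\<^bsub>N-1\<^esub>(u)\<close> and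
  \<open>K\<^bsub>N-1\<^esub>(u) = (1 + q\<^bsup>2N-2\<^esup>/u) K\<^sub>N(u)\<close>. Since \<open>|F\<^sub>q| = 1\<close>, the Fourier transform is an absolutely
  convergent sum over \<open>n\<close> of means over the circles \<open>|z| = q\<^sup>n\<close>. Inside each mean the contour can be
  moved inwards, where both \<open>K\<^sub>N\<close> and the continuation of \<open>f\<close> are holomorphic; with the two
  functional equations this turns the terms for one side of each relation into those for the other.
  For the transforms of \<open>dR f\<close> and \<open>dR_bar f\<close> the two halves of the difference quotient are not
  integrable separately, but they leave a telescoping sum whose boundary terms tend to \<open>0\<close>. For the
  derivatives of the transform, the continuation in \<open>\<zeta>\<close> is obtained termwise; the functional
  equations bound the terms by the two given integrable functions on both edges of the strip, and
  the maximum principle does the rest.\<close>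

text \<open>Continuations from different circles are unrelated functions, so every kernel carries
  the index of its circle. \<open>K\<^sub>N\<close> has a pole on the edge of its punctured disc,
  hence contours can only move towards smaller radii. Lowering the index at a fixed point changes
  only the numerator, by a factor 1 + q^(-2) cnj u, and leads to the relations with cnj z. Passing
  from u to q^2 u while raising the index keeps the argument of the numerator and drops one factor
  of the denominator; this gives 1 + u and leads to the relations with z. In both factors the
  summand 1 reproduces a term that the difference quotient or the telescoping cancels, and the other
  summand is the multiplication operator. The powers of q in the constants have three sources: the
  ratio q^2 of the weights of neighbouring circles, the scaling z = q w, and the q^(-2) of the
  numerator equation.\<close>

section \<open>Continuation of the quantum exponential function from circles\<close>

text \<open>In q-series notation this is the Pochhammer symbol (-x; q^2) with infinitely many
  factors.\<close>

definition qprod :: "real \<Rightarrow> complex \<Rightarrow> complex" where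
  "qprod q x = (\<Prod>k. 1 + of_real (q ^ (2 * k)) * x)"

text \<open>The continuation of \<open>F\<^sub>q\<close> from the circle \<open>|w| = q\<^sup>N\<close>. There \<open>cnj w = q\<^bsup>2N\<^esup>/w\<close>, so it is
  \<open>qprod q (q\<^bsup>2N\<^esup>/w) / qprod q w\<close> (\<open>Fq_ext_eq\<close>); for \<open>N \<le> 0\<close> the first \<open>1 - N\<close> factors of
  numerator and denominator have the same zeros and are cancelled, which leaves a function
  holomorphic on a punctured disc containing the circle.\<close>

definition Fq_ext :: "real \<Rightarrow> int \<Rightarrow> complex \<Rightarrow> complex" where
  "Fq_ext q N w = (\<Prod>i<nat (1 - N). of_real (q powi (- 2 * int i)) / w)
     * qprod q (of_real (q powi (2 * max N 1)) / w) / qprod q (of_real (q powi (2 - 2 * min N 1)) * w)"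

section \<open>Integer powers of a base between 0 and 1\<close>

locale unit_base =
  fixes q :: real
  assumes q_pos: "0 < q" and q_less_1: "q < 1"
begin

lemma q_nz [simp]: "q \<noteq> 0"
  using q_pos by simp

lemma abs_q [simp]: "\<bar>q\<bar> = q"
  using q_pos by simp

lemma powi_less_iff: "q powi m < q powi n \<longleftrightarrow> n < m"
  using power_int_strict_decreasing[of n m q] power_int_strict_decreasing[of m n q] q_pos q_less_1
  by (cases m n rule: linorder_cases) auto

lemma powi_le_iff: "q powi m \<le> q powi n \<longleftrightarrow> n \<le> m"
  using powi_less_iff[of n m] by linarith

lemma powi_eq_iff: "q powi m = q powi n \<longleftrightarrow> n = m"
  by (metis powi_le_iff order_antisym order_refl)

lemma powi_pos [simp]: "q powi n > 0"
  using q_pos by simp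

lemma powi_nonneg [simp]: "q powi n \<ge> 0"
  using q_pos by simp

lemma powi_add: "q powi (m + n) = q powi m * q powi n"
  by (simp add: power_int_add)

section \<open>The infinite product and its zeros\<close>

lemma summable_q2: "summable (\<lambda>k. q ^ (2 * k))"
  using q_pos q_less_1 by (simp add: power_mult summable_geometric power_less_one_iff)

lemma convergent_qprod: "convergent_prod (\<lambda>k. 1 + of_real (q ^ (2 * k)) * (x::complex))"
proof -
  have "summable (\<lambda>k. norm (of_real (q ^ (2 * k)) * x))"
    using summable_mult2[OF summable_q2, of "norm x"] q_pos by (simp add: norm_mult norm_power)
  then have "summable (\<lambda>k. norm (1 + of_real (q ^ (2 * k)) * x - 1))"
    by simp
  then show ?thesis
    by (intro abs_convergent_prod_imp_convergent_prod)
       (simp only: abs_convergent_prod_conv_summable)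
qed

lemma qprod_shift: "qprod q x = (\<Prod>i<n. 1 + of_real (q ^ (2 * i)) * x) * qprod q (of_real (q ^ (2 * n)) * x)"
proof -
  have "qprod q x = (\<Prod>i<n. 1 + of_real (q ^ (2 * i)) * x) * (\<Prod>k. 1 + of_real (q ^ (2 * (k + n))) * x)"
    unfolding qprod_def by (rule has_prod_unique[symmetric, OF has_prod_ignore_initial_segment'[OF convergent_qprod]])
  then show ?thesis
    by (simp add: qprod_def power_add algebra_simps)
qed

lemma qprod_step: "qprod q x = (1 + x) * qprod q (of_real (q ^ 2) * x)"
  using qprod_shift[of x 1] by simp

lemma qprod_eq_0_imp: 
  assumes "qprod q x = 0" obtains k :: nat where "x = - of_real (q powi (- 2 * int k))"
proof -
  have "(\<lambda>k. 1 + of_real (q ^ (2 * k)) * x) has_prod qprod q x"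
    unfolding qprod_def by (rule convergent_prod_has_prod[OF convergent_qprod])
  then obtain k where "1 + of_real (q ^ (2 * k)) * x = 0"
    using assms has_prod_eq_0_iff by fastforce
  then have "of_real (q ^ (2 * k)) * x = -1"
    by (simp add: add_eq_0_iff)
  then have "x = - of_real (inverse (q ^ (2 * k)))"
    by (simp add: field_simps)
  also have "inverse (q ^ (2 * k)) = q powi (- 2 * int k)"
    by (simp add: power_int_def nat_mult_distrib power_inverse)
  finally show ?thesis using that by blast
qed

lemma qprod_nz: "norm x < 1 \<Longrightarrow> qprod q x \<noteq> 0"
proof
  assume x: "norm x < 1" and "qprod q x = 0"
  then obtain k where "x = - of_real (q powi (- 2 * int k))"
    using qprod_eq_0_imp by blast
  then have "norm x = q powi (- 2 * int k)" by (simp add: norm_power_int norm_inverse)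
  moreover have "q powi (- 2 * int k) \<ge> q powi 0" by (subst powi_le_iff) simp
  ultimately show False using x by simp
qed

lemma qprod_0 [simp]: "qprod q 0 = 1"
  by (simp add: qprod_def)

text \<open>The partial products converge locally uniformly: on \<open>cball z 1\<close> the factor
  with index n differs from 1 by at most q^(2n) (|z| + 1), which is summable.\<close>

lemma qprod_holomorphic: "qprod q holomorphic_on UNIV"
proof (rule holomorphic_uniform_sequence)
  let ?f = "\<lambda>n z. \<Prod>k<n. 1 + complex_of_real (q ^ (2 * k)) * z"
  show "\<exists>d>0. cball z d \<subseteq> UNIV \<and> uniform_limit (cball z d) ?f (qprod q) sequentially" for z
  proof (intro exI[of _ 1] conjI)
    have "uniformly_convergent_on (cball z 1) ?f"
    proof (rule uniformly_convergent_on_prod')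
      show "uniformly_convergent_on (cball z 1) (\<lambda>N x. \<Sum>n<N. norm (1 + complex_of_real (q ^ (2 * n)) * x - 1))"
      proof (rule Weierstrass_m_test')
        show "norm (norm (1 + complex_of_real (q ^ (2 * n)) * x - 1)) \<le> q ^ (2 * n) * (norm z + 1)"
          if "x \<in> cball z 1" for n x
        proof -
          have "norm x \<le> norm z + 1"
            using that norm_triangle_ineq2[of x z] by (simp add: dist_norm norm_minus_commute)
          then show ?thesis
            using q_pos by (auto simp: norm_mult norm_power intro!: mult_left_mono)
        qed
        show "summable (\<lambda>n. q ^ (2 * n) * (norm z + 1))"
          by (rule summable_mult2[OF summable_q2])
      qed
    qed (auto intro!: continuous_intros)
    then obtain g where g: "uniform_limit (cball z 1) ?f g sequentially"
      by (auto simp: uniformly_convergent_on_def)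
    have "g x = qprod q x" if "x \<in> cball z 1" for x
    proof -
      have "(\<lambda>n. ?f n x) \<longlonglongrightarrow> g x" by (rule tendsto_uniform_limitI[OF g that])
      moreover have "(\<lambda>n. ?f n x) \<longlonglongrightarrow> qprod q x"
        using convergent_prod_LIMSEQ[OF convergent_qprod, of x]
        by (simp add: qprod_def LIMSEQ_lessThan_iff_atMost)
      ultimately show ?thesis by (rule LIMSEQ_unique)
    qed
    with g show "uniform_limit (cball z 1) ?f (qprod q) sequentially"
      by (metis (no_types, lifting) uniform_limit_cong')
  qed auto
qed (auto intro!: holomorphic_intros)

lemma qprod_cnj: "qprod q (cnj x) = cnj (qprod q x)"
proof -
  have "(\<lambda>n. \<Prod>k\<le>n. 1 + complex_of_real (q ^ (2 * k)) * cnj x) \<longlonglongrightarrow> qprod q (cnj x)"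
    unfolding qprod_def by (rule convergent_prod_LIMSEQ[OF convergent_qprod])
  moreover have "(\<lambda>n. cnj (\<Prod>k\<le>n. 1 + complex_of_real (q ^ (2 * k)) * x)) \<longlonglongrightarrow> cnj (qprod q x)"
    unfolding qprod_def by (intro tendsto_intros convergent_prod_LIMSEQ[OF convergent_qprod])
  ultimately show ?thesis by (simp add: LIMSEQ_unique)
qed

text \<open>For N \<le> 0 the zeros common to numerator and denominator are the points -q^(-2i) with
  0 \<le> i \<le> -N. Splitting 1 - N factors off both products isolates exactly these; each pair of
  matching factors has quotient q^(-2i) / w, the monomial in \<open>Fq_ext\<close>.\<close>

lemma Fq_ext_eq:
  assumes w: "w \<noteq> 0" and nz: "qprod q w \<noteq> 0"
  shows "Fq_ext q N w = qprod q (of_real (q powi (2 * N)) / w) / qprod q w"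
proof (cases "N \<ge> 1")
  case True
  then show ?thesis by (simp add: Fq_ext_def)
next
  case False
  define M where "M = nat (1 - N)"
  have M: "int M = 1 - N" using False by (simp add: M_def)
  define A where "A = (\<Prod>i<M. 1 + of_real (q ^ (2 * i)) * w)"
  define B where "B = qprod q (of_real (q ^ (2 * M)) * w)"
  have q2M: "q powi (2 - 2 * min N 1) = q ^ (2 * M)"
  proof -
    have "2 - 2 * min N 1 = int (2 * M)" using M False by simp
    then show ?thesis by (simp only: power_int_of_nat)
  qed
  have wAB: "qprod q w = A * B" unfolding A_def B_def by (rule qprod_shift)
  have "qprod q (of_real (q powi (2 * N)) / w) = (\<Prod>i<M. 1 + of_real (q ^ (2 * i)) * (of_real (q powi (2 * N)) / w))
      * qprod q (of_real (q ^ (2 * M)) * (of_real (q powi (2 * N)) / w))"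
    by (rule qprod_shift)
  also have "of_real (q ^ (2 * M)) * (of_real (q powi (2 * N)) / w) = of_real (q powi 2) / w"
  proof -
    have "q ^ (2 * M) * q powi (2 * N) = q powi (int (2 * M) + 2 * N)"
      by (simp only: powi_add power_int_of_nat)
    also have "int (2 * M) + 2 * N = 2" using M by simp
    finally show ?thesis by (metis of_real_mult times_divide_eq_right)
  qed
  \<comment> \<open>The numerator factors meet the denominator factors in reverse order: 2(M - 1 -
    i) + 2N = -2i since M = 1 - N.\<close>
  also have "(\<Prod>i<M. 1 + of_real (q ^ (2 * i)) * (of_real (q powi (2 * N)) / w))
      = (\<Prod>i<M. 1 + of_real (q ^ (2 * (M - Suc i))) * (of_real (q powi (2 * N)) / w))"
    by (rule prod.nat_diff_reindex[symmetric])
  also have "\<dots> = (\<Prod>i<M. (of_real (q powi (- 2 * int i)) / w) * (1 + of_real (q ^ (2 * i)) * w))"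
  proof (rule prod.cong[OF refl])
    fix i assume i: "i \<in> {..<M}"
    have "q ^ (2 * (M - Suc i)) * q powi (2 * N) = q powi (int (2 * (M - Suc i)) + 2 * N)"
      by (simp only: powi_add power_int_of_nat)
    also have "int (2 * (M - Suc i)) + 2 * N = - 2 * int i"
      using M i by (simp add: of_nat_diff)
    finally have 1: "complex_of_real (q ^ (2 * (M - Suc i))) * (of_real (q powi (2 * N)) / w) = of_real (q powi (- 2 * int i)) / w"
      by (metis of_real_mult times_divide_eq_right)
    have "q powi (- 2 * int i) * q ^ (2 * i) = q powi (- 2 * int i + int (2 * i))"
      by (simp only: powi_add power_int_of_nat)
    also have "\<dots> = 1" by simp
    finally have 2: "complex_of_real (q powi (- 2 * int i)) * of_real (q ^ (2 * i)) = 1"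
      by (metis of_real_1 of_real_mult)
    show "1 + complex_of_real (q ^ (2 * (M - Suc i))) * (of_real (q powi (2 * N)) / w)
        = (of_real (q powi (- 2 * int i)) / w) * (1 + of_real (q ^ (2 * i)) * w)"
      unfolding 1 using 2 w by (simp add: field_simps)
  qed
  also have "\<dots> = (\<Prod>i<M. of_real (q powi (- 2 * int i)) / w) * A"
    by (simp only: A_def prod.distrib)
  finally show ?thesis
    using nz wAB False unfolding Fq_ext_def q2M M_def[symmetric] B_def[symmetric]
    by (simp add: field_simps)
qed

text \<open>The modulus of the first zero left in the denominator after the cancellation, that is,
  of the nearest pole outside the circle.\<close>

definition Fq_ext_radius :: "int \<Rightarrow> real" where "Fq_ext_radius N = q powi (2 * min N 1 - 2)"

lemma Fq_ext_radius_gt: "q powi N < Fq_ext_radius N"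
  unfolding Fq_ext_radius_def by (subst powi_less_iff) auto

lemma Fq_ext_holomorphic: "Fq_ext q N holomorphic_on (ball 0 (Fq_ext_radius N) - {0})"
proof -
  have H: "(\<lambda>z. qprod q (g z)) holomorphic_on S" if "g holomorphic_on S" for g S
    using holomorphic_on_compose[OF that holomorphic_on_subset[OF qprod_holomorphic subset_UNIV]]
    by (simp add: o_def)
  have nz: "qprod q (of_real (q powi (2 - 2 * min N 1)) * w) \<noteq> 0" if "w \<in> ball 0 (Fq_ext_radius N) - {0}" for w
  proof (rule qprod_nz)
    have "norm (of_real (q powi (2 - 2 * min N 1)) * w) = q powi (2 - 2 * min N 1) * norm w"
      by (simp add: norm_mult norm_power_int)
    also have "\<dots> < q powi (2 - 2 * min N 1) * q powi (2 * min N 1 - 2)"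
      using that by (intro mult_strict_left_mono) (auto simp: Fq_ext_radius_def)
    also have "\<dots> = 1" by (simp flip: powi_add)
    finally show "norm (complex_of_real (q powi (2 - 2 * min N 1)) * w) < 1" .
  qed
  show ?thesis
    unfolding Fq_ext_def by (intro holomorphic_intros H nz) auto
qed

lemma qprod_nz': "w \<noteq> - of_real (norm w) \<Longrightarrow> qprod q w \<noteq> 0"
proof
  assume w: "w \<noteq> - of_real (norm w)" and "qprod q w = 0"
  then obtain k where "w = - of_real (q powi (- 2 * int k))"
    using qprod_eq_0_imp by blast
  moreover from this have "norm w = q powi (- 2 * int k)" by (simp only: norm_minus_cancel norm_of_real) simp
  ultimately show False using w by simp
qed

text \<open>No point of a circle is isolated in it, so continuity fills in the exceptional point p.
  In the applications p is the negative real point of the circle.\<close>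

lemma sphere_agree:
  fixes f g :: "complex \<Rightarrow> 'a::t2_space"
  assumes r: "r > 0" and f: "continuous_on (sphere 0 r) f" and g: "continuous_on (sphere 0 r) g"
    and eq: "\<And>w. norm w = r \<Longrightarrow> w \<noteq> p \<Longrightarrow> f w = g w" and z: "norm z = r"
  shows "f z = g z"
proof (cases "z = p")
  case False
  then show ?thesis using eq z by blast
next
  case True
  have "connected (sphere (0::complex) r)" by (rule connected_sphere) simp
  moreover have "- z \<in> sphere 0 r" "z \<in> sphere 0 r" "- z \<noteq> z" using z r by (auto simp: neg_eq_iff_add_eq_0)
  ultimately have "z islimpt sphere 0 r" by (metis connected_imp_perfect singletonD)
  then have nt: "at z within sphere 0 r \<noteq> bot" by (simp add: trivial_limit_within)
  have F: "(f \<longlongrightarrow> f z) (at z within sphere 0 r)" and G: "(g \<longlongrightarrow> g z) (at z within sphere 0 r)"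
    using f g z by (auto simp: continuous_on_def)
  have "eventually (\<lambda>w. f w = g w) (at z within sphere 0 r)"
    using eq True by (auto simp: eventually_at_filter)
  then have "(g \<longlongrightarrow> f z) (at z within sphere 0 r)" by (rule Lim_transform_eventually[OF F])
  then show ?thesis by (rule tendsto_unique[OF nt _ G])
qed

section \<open>Functional equations of the circle continuations\<close>

lemma Fq_ext_continuous_sphere: "M \<ge> N \<Longrightarrow> continuous_on (sphere 0 (q powi M)) (Fq_ext q N)"
proof (rule continuous_on_subset[OF holomorphic_on_imp_continuous_on[OF Fq_ext_holomorphic[of N]]])
  assume "M \<ge> N"
  then have "q powi M < Fq_ext_radius N" using Fq_ext_radius_gt[of N] powi_le_iff[of M N] by linarith
  then show "sphere 0 (q powi M) \<subseteq> ball 0 (Fq_ext_radius N) - {0}" using powi_pos[of M] by auto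
qed

text \<open>The numerator arguments agree, because q^(2N) / (q^2 u) = q^(2(N-1)) / u, and the
  denominators differ by the first factor 1 + u. The left side is evaluated one circle inside the
  circle of index N.\<close>

lemma Fq_ext_scale:
  assumes u: "norm u = q powi (N - 1)"
  shows "Fq_ext q N (of_real (q ^ 2) * u) = (1 + u) * Fq_ext q (N - 1) u"
proof (rule sphere_agree[where f = "\<lambda>u. Fq_ext q N (of_real (q ^ 2) * u)" and g = "\<lambda>u. (1 + u) * Fq_ext q (N - 1) u"
      and r = "q powi (N - 1)" and p = "- of_real (q powi (N - 1))"])
  show "continuous_on (sphere 0 (q powi (N - 1))) (\<lambda>u. Fq_ext q N (of_real (q ^ 2) * u))"
  proof (rule continuous_on_compose2[OF Fq_ext_continuous_sphere[of N "N + 1"]])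
    have "q ^ 2 * q powi (N - 1) = q powi (int 2 + (N - 1))" by (simp only: powi_add power_int_of_nat)
    also have "int 2 + (N - 1) = N + 1" by simp
    finally show "(\<lambda>u. complex_of_real (q ^ 2) * u) ` sphere 0 (q powi (N - 1)) \<subseteq> sphere 0 (q powi (N + 1))"
      by (auto simp: dist_norm norm_mult norm_power)
  qed (auto intro!: continuous_intros)
  show "continuous_on (sphere 0 (q powi (N - 1))) (\<lambda>u. (1 + u) * Fq_ext q (N - 1) u)"
    by (intro continuous_intros Fq_ext_continuous_sphere) simp
  fix w :: complex assume w: "norm w = q powi (N - 1)" "w \<noteq> - of_real (q powi (N - 1))"
  have w0: "w \<noteq> 0" using w powi_pos[of "N - 1"] by auto
  have nz: "qprod q w \<noteq> 0" using w by (intro qprod_nz') simp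
  have st: "qprod q w = (1 + w) * qprod q (of_real (q ^ 2) * w)" by (rule qprod_step)
  have e: "of_real (q powi (2 * N)) / (of_real (q ^ 2) * w) = complex_of_real (q powi (2 * (N - 1))) / w"
  proof -
    have "q ^ 2 * q powi (2 * (N - 1)) = q powi (int 2 + 2 * (N - 1))"
      by (simp only: powi_add power_int_of_nat)
    also have "int 2 + 2 * (N - 1) = 2 * N" by simp
    finally have "q powi (2 * N) = q ^ 2 * q powi (2 * (N - 1))" by simp
    then have "complex_of_real (q powi (2 * N)) = of_real (q ^ 2) * of_real (q powi (2 * (N - 1)))"
      by (metis of_real_mult)
    then show ?thesis using w0 by simp
  qed
  have "Fq_ext q N (of_real (q ^ 2) * w) = qprod q (of_real (q powi (2 * (N - 1))) / w) / qprod q (of_real (q ^ 2) * w)"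
    using Fq_ext_eq[of "of_real (q ^ 2) * w" N] w0 nz unfolding st e by simp
  moreover have "Fq_ext q (N - 1) w = qprod q (of_real (q powi (2 * (N - 1))) / w) / qprod q w"
    by (rule Fq_ext_eq[OF w0 nz])
  ultimately show "Fq_ext q N (of_real (q ^ 2) * w) = (1 + w) * Fq_ext q (N - 1) w"
    using nz unfolding st by simp
qed (use u in auto)

lemma conj_on_circle:
  assumes "norm w = q powi N"
  shows "of_real (q powi (2 * N)) / w = cnj w"
proof -
  have "w \<noteq> 0" using assms powi_pos[of N] by auto
  moreover have "w * cnj w = of_real (q powi (2 * N))"
  proof -
    have "q powi (2 * N) = (q powi N) ^ 2" by (simp only: mult_2 powi_add power2_eq_square)
    then show ?thesis using assms complex_norm_square[of w] by simp
  qed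
  ultimately show ?thesis by (simp add: field_simps)
qed

text \<open>The denominators agree. On this circle the numerator arguments are q^(-2) cnj u and cnj
  u, one product step apart.\<close>

lemma Fq_ext_rec:
  assumes u: "norm u = q powi N"
  shows "Fq_ext q (N - 1) u = (1 + of_real (q powi (-2)) * cnj u) * Fq_ext q N u"
proof (rule sphere_agree[where f = "\<lambda>u. Fq_ext q (N - 1) u" and g = "\<lambda>u. (1 + of_real (q powi (-2)) * cnj u) * Fq_ext q N u"
      and r = "q powi N" and p = "- of_real (q powi N)"])
  show "continuous_on (sphere 0 (q powi N)) (Fq_ext q (N - 1))"
    by (rule Fq_ext_continuous_sphere) simp
  show "continuous_on (sphere 0 (q powi N)) (\<lambda>u. (1 + of_real (q powi (-2)) * cnj u) * Fq_ext q N u)"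
    by (intro continuous_intros Fq_ext_continuous_sphere) simp
  fix w :: complex assume w: "norm w = q powi N" "w \<noteq> - of_real (q powi N)"
  have w0: "w \<noteq> 0" using w powi_pos[of N] by auto
  have nz: "qprod q w \<noteq> 0" using w by (intro qprod_nz') simp
  have e: "of_real (q powi (2 * (N - 1))) / w = of_real (q powi (-2)) * cnj w"
  proof -
    have "q powi (- 2) * q powi (2 * N) = q powi (2 * (N - 1))"
      by (simp only: powi_add[symmetric]) (simp add: algebra_simps)
    then have "q powi (2 * (N - 1)) = q powi (-2) * q powi (2 * N)" by simp
    then have "complex_of_real (q powi (2 * (N - 1))) = of_real (q powi (-2)) * of_real (q powi (2 * N))"
      by (metis of_real_mult)
    then show ?thesis by (metis conj_on_circle[OF w(1)] times_divide_eq_right)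
  qed
  have e2: "of_real (q ^ 2) * (of_real (q powi (-2)) * cnj w) = cnj w"
    by (simp add: power_int_def field_simps power2_eq_square flip: of_real_power)
  have "Fq_ext q (N - 1) w = qprod q (of_real (q powi (-2)) * cnj w) / qprod q w"
    using Fq_ext_eq[OF w0 nz, of "N - 1"] unfolding e .
  also have "\<dots> = (1 + of_real (q powi (-2)) * cnj w) * qprod q (cnj w) / qprod q w"
    by (subst qprod_step) (simp only: e2)
  finally show "Fq_ext q (N - 1) w = (1 + of_real (q powi (-2)) * cnj w) * Fq_ext q N w" 
    using Fq_ext_eq[OF w0 nz, of N] unfolding conj_on_circle[OF w(1)] by simp
qed (use u in auto)

text \<open>On its own circle the numerator is the complex conjugate of the denominator. This bound
  by 1 is what makes all series of transforms converge absolutely.\<close>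

lemma norm_Fq_ext:
  assumes u: "norm u = q powi N"
  shows "norm (Fq_ext q N u) = 1"
proof (rule sphere_agree[where f = "\<lambda>u. norm (Fq_ext q N u)" and g = "\<lambda>u. 1"
      and r = "q powi N" and p = "- of_real (q powi N)"])
  show "continuous_on (sphere 0 (q powi N)) (\<lambda>u. norm (Fq_ext q N u))"
    by (intro continuous_intros Fq_ext_continuous_sphere) simp
  fix w :: complex assume w: "norm w = q powi N" "w \<noteq> - of_real (q powi N)"
  have w0: "w \<noteq> 0" using w powi_pos[of N] by auto
  have nz: "qprod q w \<noteq> 0" using w by (intro qprod_nz') simp
  show "norm (Fq_ext q N w) = 1"
    using Fq_ext_eq[OF w0 nz, of N] nz unfolding conj_on_circle[OF w(1)] by (simp add: qprod_cnj norm_divide)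
qed (use u in auto)

section \<open>The quantum exponential function on \<open>Gam_bar q\<close>\<close>

lemma Fq_eq:
  assumes "qprod q z \<noteq> 0"
  shows "Fq q z = qprod q (cnj z) / qprod q z"
proof -
  have *: "(1::complex) + of_real (q ^ (2 * k)) * z \<noteq> 0" for k
  proof
    assume "1 + of_real (q ^ (2 * k)) * z = 0"
    then have "(\<Prod>i<Suc k. 1 + of_real (q ^ (2 * i)) * z) = 0" by simp
    then show False using assms qprod_shift[of z "Suc k"] by simp
  qed
  have "z \<noteq> - of_real (q powi (- 2 * int k))" for k
  proof
    assume z: "z = - of_real (q powi (- 2 * int k))"
    have "q ^ (2 * k) * q powi (- 2 * int k) = q powi (int (2 * k) + (- 2 * int k))"
      by (simp only: powi_add power_int_of_nat)
    also have "\<dots> = 1" by simp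
    finally have "complex_of_real (q ^ (2 * k)) * of_real (q powi (- 2 * int k)) = 1"
      by (metis of_real_1 of_real_mult)
    then show False using *[of k] z by simp
  qed
  then show ?thesis
    unfolding Fq_def Let_def qprod_def
    by (simp add: prodinf_divide[OF convergent_qprod convergent_qprod, symmetric] del: of_real_power)
qed

lemma Gam_barE:
  assumes "z \<in> Gam_bar q" "norm z > 0"
  obtains N where "norm z = q powi N"
  using assms by (auto simp: Gam_bar_def Gam_def)

text \<open>The neighbouring circles have radii q^(N+1) and q^(N-1), so every circle is relatively
  open in \<open>Gam_bar q\<close> and limits at z may be taken along its circle.\<close>

lemma eventually_same_circle:
  assumes z: "norm z = q powi N"
  shows "eventually (\<lambda>w. norm w = q powi N) (at z within Gam_bar q)"
proof -
  have "eventually (\<lambda>w. q powi (N + 1) < norm w \<and> norm w < q powi (N - 1)) (nhds z)"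
  proof -
    have "((\<lambda>w. norm w) \<longlongrightarrow> norm z) (nhds z)" by (intro tendsto_intros filterlim_ident)
    from order_tendstoD(1)[OF this, of "q powi (N + 1)"] order_tendstoD(2)[OF this, of "q powi (N - 1)"]
    have "eventually (\<lambda>w. q powi (N + 1) < norm w) (nhds z)" "eventually (\<lambda>w. norm w < q powi (N - 1)) (nhds z)"
      unfolding z powi_less_iff by simp_all
    then show ?thesis by eventually_elim auto
  qed
  then have "eventually (\<lambda>w. q powi (N + 1) < norm w \<and> norm w < q powi (N - 1)) (at z within Gam_bar q)"
    unfolding eventually_at_filter by (rule eventually_mono) simp
  moreover have "eventually (\<lambda>w. w \<in> Gam_bar q) (at z within Gam_bar q)"
    by (auto simp: eventually_at_filter)
  ultimately show ?thesis
  proof eventually_elim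
    case (elim w)
    then have "norm w > 0" using powi_pos[of "N + 1"] by linarith
    then obtain M where M: "norm w = q powi M" using elim Gam_barE by blast
    then have "M < N + 1" "N - 1 < M" using elim by (simp_all only: powi_less_iff)
    then have "M = N" by linarith
    then show ?case using M by simp
  qed
qed

lemma sphere_subset_Gam_bar: "sphere 0 (q powi N) \<subseteq> Gam_bar q"
  by (auto simp: Gam_bar_def Gam_def)

lemma Fq_ext_tendsto: 
  assumes z: "norm z = q powi N"
  shows "(Fq_ext q N \<longlongrightarrow> Fq_ext q N z) (at z within Gam_bar q)"
proof -
  have "continuous_on (ball 0 (Fq_ext_radius N) - {0}) (Fq_ext q N)"
    by (rule holomorphic_on_imp_continuous_on[OF Fq_ext_holomorphic])
  moreover have "open (ball 0 (Fq_ext_radius N) - {0::complex})" by (rule open_Diff) auto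
  moreover have "z \<in> ball 0 (Fq_ext_radius N) - {0}" using z Fq_ext_radius_gt[of N] powi_pos[of N] by auto
  ultimately have "isCont (Fq_ext q N) z" using continuous_on_eq_continuous_at by blast
  then show ?thesis by (simp add: isCont_def tendsto_within_subset[of _ _ _ UNIV])
qed

lemma limpt_Gam_bar:
  assumes z: "norm z = q powi N"
  shows "at z within Gam_bar q \<noteq> bot"
proof -
  have "connected (sphere (0::complex) (q powi N))" by (rule connected_sphere) simp
  moreover have "- z \<in> sphere 0 (q powi N)" "z \<in> sphere 0 (q powi N)" "- z \<noteq> z"
    using z powi_pos[of N] by (auto simp: neg_eq_iff_add_eq_0 simp del: powi_pos)
  ultimately have "z islimpt sphere 0 (q powi N)" by (metis connected_imp_perfect singletonD)
  then have "z islimpt Gam_bar q" by (rule islimpt_subset[OF _ sphere_subset_Gam_bar])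
  then show ?thesis by (simp add: trivial_limit_within)
qed

text \<open>At the excluded points both sides are limits along the circle of the same quotient.\<close>

lemma Fq_eq_Fq_ext:
  assumes z: "norm z = q powi N"
  shows "Fq q z = Fq_ext q N z"
proof -
  have w: "(\<Prod>k. (1 + of_real (q ^ (2 * k)) * cnj w) / (1 + of_real (q ^ (2 * k)) * w)) = Fq_ext q N w"
    if w: "norm w = q powi N" and nz: "qprod q w \<noteq> 0" for w
  proof -
    have "w \<noteq> 0" using w powi_pos[of N] by auto
    then have "Fq_ext q N w = qprod q (cnj w) / qprod q w"
      using Fq_ext_eq[OF _ nz] conj_on_circle[OF w] by simp
    then show ?thesis
      by (simp add: qprod_def prodinf_divide[OF convergent_qprod convergent_qprod, symmetric] del: of_real_power)
  qed
  show ?thesis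
  proof (cases "qprod q z = 0")
    case False
    have "z \<noteq> 0" using z powi_pos[of N] by auto
    then show ?thesis using Fq_eq[OF False] Fq_ext_eq[OF _ False, of N] conj_on_circle[OF z] by simp
  next
    case True
    then obtain k where k: "z = - of_real (q powi (- 2 * int k))" using qprod_eq_0_imp by blast
    have zN: "z = - of_real (q powi N)" using qprod_nz'[of z] True z by fastforce
    let ?P = "\<lambda>w. \<Prod>k. (1 + of_real (q ^ (2 * k)) * cnj w) / (1 + of_real (q ^ (2 * k)) * w)"
    have "eventually (\<lambda>w. Fq_ext q N w = ?P w) (at z within Gam_bar q)"
    proof -
      have "eventually (\<lambda>w. w \<noteq> z) (at z within Gam_bar q)" by (auto simp: eventually_at_filter)
      then show ?thesis using eventually_same_circle[OF z]
      proof eventually_elim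
        case (elim v)
        then have "qprod q v \<noteq> 0" using zN by (intro qprod_nz') simp
        then show ?case using w[of v] elim by simp
      qed
    qed
    then have "(?P \<longlongrightarrow> Fq_ext q N z) (at z within Gam_bar q)"
      using Fq_ext_tendsto[OF z] by (rule Lim_transform_eventually[rotated])
    then have "Lim (at z within Gam_bar q) ?P = Fq_ext q N z"
      using limpt_Gam_bar[OF z] by (intro tendsto_Lim)
    moreover have "\<exists>k::nat. z = - of_real (q powi (- 2 * int k))" using k by blast
    ultimately show ?thesis unfolding Fq_def Let_def by (simp only: if_True)
  qed
qed

lemma Fq_0: "Fq q 0 = 1"
  by (subst Fq_eq) auto

lemma norm_Fq: "z \<in> Gam_bar q \<Longrightarrow> norm (Fq q z) = 1"
  by (metis Fq_0 Fq_eq_Fq_ext Gam_barE norm_Fq_ext norm_one zero_less_norm_iff)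

lemma qprod_isCont: "isCont (qprod q) x"
  using holomorphic_on_imp_continuous_on[OF qprod_holomorphic] by (simp add: continuous_on_eq_continuous_at)

lemma Fq_tendsto_0: "(Fq q \<longlongrightarrow> 1) (at 0)"
proof -
  have "eventually (\<lambda>w. w \<in> ball 0 1) (at (0::complex))" by (intro eventually_at_in_open') auto
  then have "eventually (\<lambda>w. qprod q (cnj w) / qprod q w = Fq q w) (at (0::complex))"
    by eventually_elim (auto simp: Fq_eq qprod_nz)
  moreover have "((\<lambda>w. qprod q (cnj w) / qprod q w) \<longlongrightarrow> qprod q (cnj 0) / qprod q 0) (at 0)"
    by (intro tendsto_intros isCont_tendsto_compose[OF qprod_isCont]) auto
  ultimately show ?thesis using Lim_transform_eventually by fastforce
qed

lemma continuous_Fq: "continuous_on (Gam_bar q) (Fq q)"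
  unfolding continuous_on_def
proof
  fix z assume z: "z \<in> Gam_bar q"
  show "(Fq q \<longlongrightarrow> Fq q z) (at z within Gam_bar q)"
  proof (cases "z = 0")
    case True
    then show ?thesis using Fq_tendsto_0 by (simp add: Fq_0 tendsto_within_subset[of _ _ _ UNIV])
  next
    case False
    then obtain N where N: "norm z = q powi N" using z Gam_barE by auto
    have "eventually (\<lambda>w. Fq_ext q N w = Fq q w) (at z within Gam_bar q)"
      using eventually_same_circle[OF N] by eventually_elim (simp add: Fq_eq_Fq_ext)
    then show ?thesis using Fq_ext_tendsto[OF N] Fq_eq_Fq_ext[OF N] Lim_transform_eventually by fastforce
  qed
qed

end

section \<open>Circle means\<close>

text \<open>With this normalisation the mean of a function holomorphic near the circle is the
  constant coefficient of its Laurent expansion.\<close>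

definition circle_mean :: "real \<Rightarrow> (complex \<Rightarrow> 'a::real_normed_vector) \<Rightarrow> 'a" where
  "circle_mean r f = integral {0..2 * pi} (\<lambda>\<theta>. f (of_real r * cis \<theta>)) /\<^sub>R (2 * pi)"

lemma continuous_on_circle:
  assumes "0 \<le> r" and "continuous_on (sphere 0 r) f"
  shows "continuous_on A (\<lambda>\<theta>. f (of_real r * cis \<theta>))"
  
  by (intro continuous_on_compose2[OF assms(2), of _ "\<lambda>\<theta>. of_real r * cis \<theta>"] continuous_intros)
     (use assms(1) in \<open>auto simp: norm_mult\<close>)

lemma circle_mean_integrable:
  fixes f :: "complex \<Rightarrow> 'a::euclidean_space"
  assumes "0 \<le> r" and "continuous_on (sphere 0 r) f"
  shows "(\<lambda>\<theta>. f (of_real r * cis \<theta>)) integrable_on {0..2 * pi}"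
  by (intro integrable_continuous_real continuous_on_circle assms)

lemma circle_mean_cong:
  assumes "0 \<le> r" and "\<And>z. norm z = r \<Longrightarrow> f z = g z"
  shows "circle_mean r f = circle_mean r g"
  unfolding circle_mean_def using assms by (intro arg_cong2[where f = scaleR] Henstock_Kurzweil_Integration.integral_cong) (auto simp: norm_mult)

lemma circle_mean_add:
  fixes f g :: "complex \<Rightarrow> 'a::euclidean_space"
  assumes "0 \<le> r" "continuous_on (sphere 0 r) f" "continuous_on (sphere 0 r) g"
  shows "circle_mean r (\<lambda>z. f z + g z) = circle_mean r f + circle_mean r g"
  unfolding circle_mean_def
  by (simp add: Henstock_Kurzweil_Integration.integral_add circle_mean_integrable assms scaleR_add_right)

lemma circle_mean_cmult:
  fixes f :: "complex \<Rightarrow> 'a::real_normed_field"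
  shows "circle_mean r (\<lambda>z. c * f z) = c * circle_mean r f"
  unfolding circle_mean_def by (simp add: Henstock_Kurzweil_Integration.integral_mult_right)

lemma circle_mean_scale: "circle_mean r (\<lambda>z. f (of_real c * z)) = circle_mean (c * r) f"
  unfolding circle_mean_def by (simp add: mult.assoc)

lemma norm_circle_mean_le:
  fixes f :: "complex \<Rightarrow> 'a::euclidean_space"
  assumes "0 \<le> r" "continuous_on (sphere 0 r) f" "continuous_on (sphere 0 r) g"
    and "\<And>z. norm z = r \<Longrightarrow> norm (f z) \<le> g z"
  shows "norm (circle_mean r f) \<le> circle_mean r g"
  unfolding circle_mean_def using assms
  by (auto simp: norm_mult intro!: mult_left_mono divide_right_mono integral_norm_bound_integral circle_mean_integrable)

lemma circle_mean_const: "circle_mean r (\<lambda>z. c) = (c::'a::euclidean_space)"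
  unfolding circle_mean_def by simp

lemma circle_mean_mono:
  fixes f g :: "complex \<Rightarrow> real"
  assumes "0 \<le> r" "continuous_on (sphere 0 r) f" "continuous_on (sphere 0 r) g"
    and "\<And>z. norm z = r \<Longrightarrow> f z \<le> g z"
  shows "circle_mean r f \<le> circle_mean r g"
  unfolding circle_mean_def using assms
  by (auto simp: norm_mult intro!: mult_left_mono divide_right_mono integral_le circle_mean_integrable)

lemma circle_mean_nonneg:
  assumes "0 \<le> r" "continuous_on (sphere 0 r) g" "\<And>z. g z \<ge> (0::real)"
  shows "0 \<le> circle_mean r g"
  using circle_mean_mono[of r "\<lambda>_. 0" g] assms by (simp add: circle_mean_const)

lemma circle_mean_contour:
  assumes "0 < r"
  shows "contour_integral (circlepath 0 r) (\<lambda>z. f z / z) = 2 * pi * \<i> * circle_mean r f"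
proof -
  have "contour_integral (circlepath 0 r) (\<lambda>z. f z / z)
      = integral {0..2 * pi} (\<lambda>t. f (0 + r * cis t) / (0 + r * cis t) * r * \<i> * cis t)"
    unfolding circlepath_def by (rule contour_integral_part_circlepath_eq) simp
  also have "\<dots> = integral {0..2 * pi} (\<lambda>t. \<i> * f (r * cis t))"
    using assms by (intro Henstock_Kurzweil_Integration.integral_cong) simp
  also have "\<dots> = \<i> * integral {0..2 * pi} (\<lambda>t. f (r * cis t))"
    by (rule Henstock_Kurzweil_Integration.integral_mult_right)
  finally show ?thesis
    unfolding circle_mean_def by (simp add: scaleR_conv_of_real)
qed

text \<open>The mean is a contour integral of f z / z up to the factor 2 pi i, and by Cauchy's
  theorem that integral is the same for all circles in the punctured disc.\<close>

lemma circle_mean_radius: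
  assumes f: "f holomorphic_on ball 0 R - {0}" and "0 < r" "r < R" "0 < s" "s < R"
  shows "circle_mean r f = circle_mean s f"
proof -
  have *: "circle_mean a f = circle_mean b f" if "0 < a" "a \<le> b" "b < R" for a b
  proof -
    have "(\<lambda>z. f z / z) holomorphic_on ball 0 R - {0}"
      using f by (intro holomorphic_intros) auto
    then have "contour_integral (circlepath 0 b) (\<lambda>z. f z / z) = contour_integral (circlepath 0 a) (\<lambda>z. f z / z)"
      using that by (intro contour_integral_circlepath_eq(3)[of "ball 0 R"]) auto
    then show ?thesis using that by (simp add: circle_mean_contour)
  qed
  show ?thesis
  proof (cases "r \<le> s")
    case True
    then show ?thesis using assms by (intro *) auto
  next
    case False
    then show ?thesis using assms by (intro *[symmetric]) auto
  qed
qed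

text \<open>Writing e = \<open>cis a\<close> turns the left side into the integral of a 2 pi
  periodic function over the period shifted by a.\<close>

lemma circle_mean_rotate:
  fixes f :: "complex \<Rightarrow> 'a::euclidean_space"
  assumes r: "0 \<le> r" and f: "continuous_on (sphere 0 r) f" and e: "norm e = 1"
  shows "circle_mean r (\<lambda>z. f (e * z)) = circle_mean r f"
proof -
  define g where "g = (\<lambda>\<theta>. f (of_real r * cis \<theta>))"
  have g: "continuous_on A g" for A unfolding g_def by (rule continuous_on_circle[OF r f])
  have gi: "g integrable_on {a..b}" for a b by (rule integrable_continuous_real[OF g])
  define a where "a = Arg2pi e"
  have a: "0 \<le> a" "a \<le> 2 * pi" using Arg2pi_ge_0[of e] Arg2pi_lt_2pi[of e] by (auto simp: a_def)
  have ec: "e = cis a" using Arg2pi_eq[of e] e by (simp add: a_def cis_conv_exp)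
  have per: "g (t + 2 * pi) = g t" for t
    by (simp add: g_def cis_mult[symmetric] complex_eq_iff)
  have sh: "integral {u + c..v + c} g = integral {u..v} (\<lambda>t. g (t + c))" for u v c
    using integral_shift_Icc_real[of u v g c] by (simp add: o_def add.commute)
  have "integral {0..2 * pi} (\<lambda>t. g (t + a)) = integral {a..2 * pi + a} g"
    using sh[of 0 a "2 * pi"] by simp
  also have "\<dots> = integral {a..2 * pi} g + integral {2 * pi..2 * pi + a} g"
    using a gi by (intro Henstock_Kurzweil_Integration.integral_combine[symmetric]) auto
  also have "integral {2 * pi..2 * pi + a} g = integral {0..a} g"
    using sh[of 0 "2 * pi" a] per by (simp add: add.commute)
  also have "integral {a..2 * pi} g + integral {0..a} g = integral {0..2 * pi} g"
    using a gi Henstock_Kurzweil_Integration.integral_combine[of 0 a "2 * pi" g] by (simp add: add.commute)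
  also have "(\<lambda>t. g (t + a)) = (\<lambda>\<theta>. f (e * (of_real r * cis \<theta>)))"
    by (simp add: g_def ec cis_mult[symmetric] mult_ac)
  finally show ?thesis by (simp add: circle_mean_def g_def)
qed

lemma circle_mean_holomorphic:
  assumes f: "f holomorphic_on D" and D: "open D" and g: "continuous_on (sphere 0 r) g" and r: "0 < r"
    and U: "open U" and UD: "\<And>x z. x \<in> U \<Longrightarrow> norm z = r \<Longrightarrow> x * z \<in> D"
  shows "(\<lambda>x. circle_mean r (\<lambda>z. f (x * z) * g z)) holomorphic_on U"
proof -
  let ?z = "\<lambda>\<theta>. complex_of_real r * cis \<theta>"
  have nz: "norm (?z \<theta>) = r" for \<theta> using r by (simp add: norm_mult)
  have gc: "continuous_on A (\<lambda>\<theta>. g (?z \<theta>))" for A by (rule continuous_on_circle[OF less_imp_le[OF r] g])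
  have fc: "continuous_on D f" "continuous_on D (deriv f)"
    using f D by (auto intro: holomorphic_on_imp_continuous_on holomorphic_deriv)
  \<comment> \<open>The Leibniz rule is applied on convex sets, hence on balls first; the claim on U
    follows pointwise.\<close>
  have local: "(\<lambda>x. integral (cbox 0 (2 * pi)) (\<lambda>\<theta>. f (x * ?z \<theta>) * g (?z \<theta>))) holomorphic_on ball x0 e"
    if sub: "ball x0 e \<subseteq> U" for x0 e
  proof (rule leibniz_rule_holomorphic)
    fix x \<theta> assume x: "x \<in> ball x0 e"
    then have xD: "x * ?z \<theta> \<in> D" using UD sub nz by blast
    have "(f has_field_derivative deriv f (x * ?z \<theta>)) (at (x * ?z \<theta>))"
      using f D xD by (rule holomorphic_derivI)
    then have "((\<lambda>x. f (x * ?z \<theta>)) has_field_derivative deriv f (x * ?z \<theta>) * ?z \<theta>) (at x within ball x0 e)"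
      by (rule DERIV_chain2) (auto intro!: derivative_eq_intros)
    then show "((\<lambda>x. f (x * ?z \<theta>) * g (?z \<theta>)) has_field_derivative deriv f (x * ?z \<theta>) * ?z \<theta> * g (?z \<theta>)) (at x within ball x0 e)"
      by (rule DERIV_cmult_right)
  next
    fix x assume x: "x \<in> ball x0 e"
    then have xD: "x * ?z \<theta> \<in> D" for \<theta> using UD sub nz by blast
    have "continuous_on (cbox 0 (2 * pi)) (\<lambda>\<theta>. f (x * ?z \<theta>) * g (?z \<theta>))"
      by (intro continuous_intros gc continuous_on_compose2[OF fc(1)]) (use xD in auto)
    then show "(\<lambda>\<theta>. f (x * ?z \<theta>) * g (?z \<theta>)) integrable_on cbox 0 (2 * pi)"
      by (rule integrable_continuous)
  next
    have xD: "x * ?z \<theta> \<in> D" if "x \<in> ball x0 e" for x \<theta> using UD sub nz that by blast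
    show "continuous_on (ball x0 e \<times> cbox 0 (2 * pi)) (\<lambda>(x, \<theta>). deriv f (x * ?z \<theta>) * ?z \<theta> * g (?z \<theta>))"
      unfolding case_prod_unfold
      by (intro continuous_intros continuous_on_compose2[OF fc(2)] continuous_on_compose2[OF gc[of UNIV] continuous_on_snd])
         (use xD in auto)
  qed auto
  have "(\<lambda>x. integral (cbox 0 (2 * pi)) (\<lambda>\<theta>. f (x * ?z \<theta>) * g (?z \<theta>))) holomorphic_on U"
    unfolding holomorphic_on_def
  proof
    fix x assume "x \<in> U"
    then obtain e where e: "e > 0" "ball x e \<subseteq> U" using U open_contains_ball by blast
    have "(\<lambda>x. integral (cbox 0 (2 * pi)) (\<lambda>\<theta>. f (x * ?z \<theta>) * g (?z \<theta>))) field_differentiable (at x)"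
      by (rule holomorphic_on_imp_differentiable_at[OF local[OF e(2)]]) (use e in auto)
    then show "(\<lambda>x. integral (cbox 0 (2 * pi)) (\<lambda>\<theta>. f (x * ?z \<theta>) * g (?z \<theta>))) field_differentiable (at x within U)"
      by (rule field_differentiable_at_within)
  qed
  then show ?thesis
    unfolding circle_mean_def scaleR_conv_of_real by (intro holomorphic_intros) (simp add: cbox_interval)
qed

section \<open>Continuation across a strip\<close>

text \<open>Extended by \<open>0\<close> below the real line, \<open>D\<close> is holomorphic across it and vanishes on an open set.\<close>

lemma strip_zero_pos:
  assumes c: "(c::real) > 0" and cont: "continuous_on {t. 0 \<le> Im t \<and> Im t \<le> c} D"
    and hol: "D holomorphic_on {t. 0 < Im t \<and> Im t < c}" and re: "\<And>t::real. D (of_real t) = 0"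
  shows "D (\<i> * of_real c) = 0"
proof -
  define W where "W = {t. - c < Im t} \<inter> {t. Im t < c}"
  have W: "open W" "connected W" unfolding W_def
    by (intro open_Int open_halfspace_Im_lt open_halfspace_Im_gt)
       (intro convex_connected convex_Int convex_halfspace_Im_lt convex_halfspace_Im_gt)
  define G where "G = (\<lambda>t. if 0 \<le> Im t then D t else 0)"
  have re': "D t = 0" if "Im t = 0" for t
    using re[of "Re t"] that by (metis complex_is_Real_iff of_real_Re)
  have Gcont: "continuous_on W G"
  proof -
    have eq: "W = (W \<inter> {t. 0 \<le> Im t}) \<union> (W \<inter> {t. Im t \<le> 0})" by auto
    have "continuous_on ((W \<inter> {t. 0 \<le> Im t}) \<union> (W \<inter> {t. Im t \<le> 0})) G"
      unfolding G_def
    proof (rule continuous_on_cases_local)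
      show "closedin (top_of_set (W \<inter> {t. 0 \<le> Im t} \<union> W \<inter> {t. Im t \<le> 0})) (W \<inter> {t. 0 \<le> Im t})"
        unfolding eq[symmetric] by (intro closedin_closed_Int closed_halfspace_Im_ge)
      show "closedin (top_of_set (W \<inter> {t. 0 \<le> Im t} \<union> W \<inter> {t. Im t \<le> 0})) (W \<inter> {t. Im t \<le> 0})"
        unfolding eq[symmetric] by (intro closedin_closed_Int closed_halfspace_Im_le)
      show "continuous_on (W \<inter> {t. 0 \<le> Im t}) D"
        by (rule continuous_on_subset[OF cont]) (auto simp: W_def)
    qed (use re' in auto)
    then show ?thesis unfolding eq[symmetric] .
  qed
  have "G holomorphic_on W"
  proof (rule holomorphic_on_paste_across_line[of W \<i> G 0])
    have "(\<lambda>t. 0) holomorphic_on W \<inter> {z. \<i> \<bullet> z < 0}" by simp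
    then show "G holomorphic_on W \<inter> {z. \<i> \<bullet> z < 0}"
      by (rule holomorphic_transform) (auto simp: G_def)
    have "D holomorphic_on W \<inter> {z. 0 < \<i> \<bullet> z}"
      by (rule holomorphic_on_subset[OF hol]) (auto simp: W_def)
    then show "G holomorphic_on W \<inter> {z. 0 < \<i> \<bullet> z}"
      by (rule holomorphic_transform) (auto simp: G_def)
  qed (use W Gcont in auto)
  note Ghol = this
  define V where "V = W \<inter> {t. Im t < 0}"
  have V: "open V" unfolding V_def by (intro open_Int W open_halfspace_Im_lt)
  have pV: "- \<i> * of_real (c / 2) \<in> V" using c by (auto simp: V_def W_def)
  then have lim: "- \<i> * of_real (c / 2) islimpt V"
    using V by (simp add: interior_limit_point interior_open)
  have G0: "G w = 0" if w: "w \<in> W" for w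
  proof (rule analytic_continuation[OF Ghol W _ _ lim _ w])
    show "V \<subseteq> W" by (simp add: V_def)
    then show "- \<i> * of_real (c / 2) \<in> W" using pV by blast
    show "G z = 0" if "z \<in> V" for z using that by (simp add: V_def G_def)
  qed
  \<comment> \<open>The target point lies on the edge of the strip, outside W, and is reached only
    by continuity along the imaginary axis.\<close>
  have "D (\<i> * of_real y) = 0" if "y \<in> {0..<c}" for y
    using G0[of "\<i> * of_real y"] that c by (auto simp: W_def G_def)
  moreover have "continuous_on (closure {0..<c}) (\<lambda>y. D (\<i> * of_real y))"
    using c by (intro continuous_on_compose2[OF cont] continuous_intros) auto
  ultimately show ?thesis
    using continuous_constant_on_closure[of "{0..<c}" "\<lambda>y. D (\<i> * of_real y)" 0 c] c by auto
qed

text \<open>The difference of two continuations vanishes on the real line, hence up to the far edge.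
  This justifies the description operator in \<open>dot\<close>. For s > 0 the strip lies below the
  real line and is reflected by t \<mapsto> -t.\<close>

lemma continues_to_unique:
  assumes s: "s \<noteq> 0" and 1: "continues_to q s f z w1" and 2: "continues_to q s f z w2"
  shows "w1 = w2"
proof -
  obtain h1 where h1: "continuous_on {t. Im t \<in> closed_segment 0 (- s)} h1"
      "h1 holomorphic_on {t. Im t \<in> open_segment 0 (- s)}"
      "\<And>t::real. h1 (of_real t) = f (of_real q powr (\<i> * of_real t) * z)" "h1 (- \<i> * of_real s) = w1"
    using 1 unfolding continues_to_def by blast
  obtain h2 where h2: "continuous_on {t. Im t \<in> closed_segment 0 (- s)} h2"
      "h2 holomorphic_on {t. Im t \<in> open_segment 0 (- s)}"
      "\<And>t::real. h2 (of_real t) = f (of_real q powr (\<i> * of_real t) * z)" "h2 (- \<i> * of_real s) = w2"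
    using 2 unfolding continues_to_def by blast
  define D where "D = (\<lambda>t. h1 t - h2 t)"
  have D: "continuous_on {t. Im t \<in> closed_segment 0 (- s)} D" "D holomorphic_on {t. Im t \<in> open_segment 0 (- s)}"
     "\<And>t::real. D (of_real t) = 0"
    unfolding D_def using h1 h2 by (auto intro!: continuous_intros holomorphic_intros)
  have "D (- \<i> * of_real s) = 0"
  proof (cases "s < 0")
    case True
    have "D (\<i> * of_real (- s)) = 0"
    proof (rule strip_zero_pos)
      show "continuous_on {t. 0 \<le> Im t \<and> Im t \<le> - s} D"
        by (rule continuous_on_subset[OF D(1)]) (use True in \<open>auto simp: closed_segment_eq_real_ivl\<close>)
      show "D holomorphic_on {t. 0 < Im t \<and> Im t < - s}"
        by (rule holomorphic_on_subset[OF D(2)]) (use True in \<open>auto simp: open_segment_eq_real_ivl\<close>)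
    qed (use True D(3) in auto)
    then show ?thesis by simp
  next
    case False
    with s have "s > 0" by simp
    have "(\<lambda>t. D (- t)) holomorphic_on {t. 0 < Im t \<and> Im t < s}"
      using \<open>s > 0\<close> by (intro holomorphic_on_compose_gen[OF _ D(2), unfolded o_def] holomorphic_intros)
         (auto simp: open_segment_eq_real_ivl)
    moreover have "continuous_on {t. 0 \<le> Im t \<and> Im t \<le> s} (\<lambda>t. D (- t))"
      using \<open>s > 0\<close> by (intro continuous_on_compose2[OF D(1)] continuous_intros)
         (auto simp: closed_segment_eq_real_ivl)
    ultimately have "D (- (\<i> * of_real s)) = 0"
      using D(3) \<open>s > 0\<close> by (intro strip_zero_pos[where D = "\<lambda>t. D (- t)"]) (auto simp flip: of_real_minus)
    then show ?thesis by simp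
  qed
  then show ?thesis using h1(4) h2(4) by (simp add: D_def)
qed

lemma dot_eq: "s \<noteq> 0 \<Longrightarrow> continues_to q s f z w \<Longrightarrow> dot q s f z = w"
  unfolding dot_def using continues_to_unique by blast

text \<open>Maximum modulus principle on the closed annulus, whose frontier consists of points of
  the two bounding circles.\<close>

lemma norm_le_annulus:
  assumes hol: "f holomorphic_on U" and U: "open U" "\<And>x. a \<le> norm x \<Longrightarrow> norm x \<le> b \<Longrightarrow> x \<in> U"
    and B: "\<And>x. norm x = a \<or> norm x = b \<Longrightarrow> norm (f x) \<le> B" and x: "a \<le> norm x" "norm x \<le> b"
  shows "norm (f x) \<le> B"
proof -
  let ?S = "cball 0 b - ball (0::complex) a"
  have cl: "closed ?S" by (intro closed_Diff) auto
  have SU: "?S \<subseteq> U" using U(2) by auto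
  show ?thesis
  proof (rule maximum_modulus_frontier[of f ?S])
    show "f holomorphic_on interior ?S"
      using interior_subset SU by (intro holomorphic_on_subset[OF hol]) blast
    show "continuous_on (closure ?S) f"
      using SU cl by (intro continuous_on_subset[OF holomorphic_on_imp_continuous_on[OF hol]]) simp
    show "bounded ?S" by (rule bounded_subset[OF bounded_cball]) auto
    fix z assume z: "z \<in> frontier ?S"
    then have zS: "z \<in> ?S" using cl frontier_subset_closed by blast
    have "ball 0 b - cball 0 a \<subseteq> interior ?S"
      by (intro interior_maximal open_Diff) auto
    then have "z \<notin> ball 0 b - cball 0 a" using z by (auto simp: frontier_def)
    then show "norm (f z) \<le> B" using zS by (intro B) auto
  qed (use x in auto)
qed

text \<open>By the maximum principle, bounds on the two boundary circles give uniform convergence in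
  the annulus between them.\<close>

lemma continues_to_series:
  fixes H :: "'i \<Rightarrow> complex \<Rightarrow> complex"
  assumes q: "0 < q" "q < 1"
    and hol: "\<And>n. H n holomorphic_on U n" and U: "\<And>n. open (U n)"
      "\<And>n x. min 1 (q powr s) \<le> norm x \<Longrightarrow> norm x \<le> max 1 (q powr s) \<Longrightarrow> x \<in> U n"
    and B: "\<And>n x. norm x = 1 \<or> norm x = q powr s \<Longrightarrow> norm (H n x) \<le> B n" "B summable_on UNIV"
    and f: "\<And>x. norm x = 1 \<Longrightarrow> ((\<lambda>n. H n x) has_sum f (x * z)) UNIV"
    and w: "((\<lambda>n. H n (of_real (q powr s))) has_sum w) UNIV"
  shows "continues_to q s f z w"
proof -
  define A where "A = {x::complex. min 1 (q powr s) \<le> norm x \<and> norm x \<le> max 1 (q powr s)}"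
  define S where "S = (\<lambda>x. \<Sum>\<^sub>\<infinity>n. H n x)"
  have HB: "norm (H n x) \<le> B n" if "x \<in> A" for n x
  proof (rule norm_le_annulus[OF hol U])
    show "norm (H n x) \<le> B n" if "norm x = min 1 (q powr s) \<or> norm x = max 1 (q powr s)" for x :: complex
      using that by (intro B(1)) (auto simp: min_def max_def split: if_splits)
  qed (use that in \<open>auto simp: A_def\<close>)
  have lim: "uniform_limit A (\<lambda>X x. \<Sum>n\<in>X. H n x) S (finite_subsets_at_top UNIV)"
    unfolding S_def by (rule Weierstrass_m_test_general[OF HB B(2)]) auto
  have AU: "A \<subseteq> U n" for n using U(2) by (auto simp: A_def)
  have Hcont: "continuous_on A (\<lambda>x. \<Sum>n\<in>X. H n x)" for X
    by (intro continuous_on_sum continuous_on_subset[OF holomorphic_on_imp_continuous_on[OF hol] AU])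
  have Scont: "continuous_on A S"
    by (rule uniform_limit_theorem[OF _ lim]) (auto intro: always_eventually Hcont)
  have Shol: "S holomorphic_on ball x e" if "cball x e \<subseteq> A" for x e
  proof (rule holomorphic_uniform_limit[of x e "\<lambda>X x. \<Sum>n\<in>X. H n x" "finite_subsets_at_top UNIV" S])
    show "\<forall>\<^sub>F X in finite_subsets_at_top UNIV. continuous_on (cball x e) (\<lambda>x. \<Sum>n\<in>X. H n x) \<and> (\<lambda>x. \<Sum>n\<in>X. H n x) holomorphic_on ball x e"
    proof (intro always_eventually allI conjI)
      fix X
      show "continuous_on (cball x e) (\<lambda>x. \<Sum>n\<in>X. H n x)" by (rule continuous_on_subset[OF Hcont that])
      have "ball x e \<subseteq> U n" for n using that AU ball_subset_cball by blast
      then show "(\<lambda>x. \<Sum>n\<in>X. H n x) holomorphic_on ball x e"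
        by (intro holomorphic_on_sum holomorphic_on_subset[OF hol])
    qed
    show "uniform_limit (cball x e) (\<lambda>X x. \<Sum>n\<in>X. H n x) S (finite_subsets_at_top UNIV)"
      by (rule uniform_limit_on_subset[OF lim that])
  qed auto
  define V where "V = {x::complex. min 1 (q powr s) < norm x} \<inter> {x. norm x < max 1 (q powr s)}"
  have V: "open V" unfolding V_def by (intro open_Int open_Collect_less continuous_intros)
  have VA: "V \<subseteq> A" by (auto simp: V_def A_def)
  have ShV: "S holomorphic_on V"
    unfolding holomorphic_on_def
  proof
    fix x assume "x \<in> V"
    then obtain e where e: "e > 0" "cball x e \<subseteq> V" using V open_contains_cball by blast
    then have "S field_differentiable at x"
      using VA by (intro holomorphic_on_imp_differentiable_at[OF Shol, of x e]) auto
    then show "S field_differentiable at x within V" by (rule field_differentiable_at_within)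
  qed
  \<comment> \<open>The modulus of q^(it) is q^(- Im t), so p carries the closed strip into the
    closed annulus A and the open strip into V. The continuation is the sum S composed with
    p.\<close>
  define p where "p = (\<lambda>t. of_real q powr (\<i> * t) :: complex)"
  have p: "p t = exp (\<i> * t * of_real (ln q))" for t
    using q by (simp add: p_def powr_def Ln_of_real)
  have np: "norm (p t) = q powr (- Im t)" for t
    using q by (simp add: p powr_def)
  have pA: "p t \<in> A" if "Im t \<in> closed_segment 0 (- s)" for t
  proof -
    have "min 1 (q powr s) \<le> q powr y \<and> q powr y \<le> max 1 (q powr s)" if "y \<in> closed_segment 0 s" for y
    proof -
      have "y * ln q \<in> closed_segment 0 (s * ln q)"
        using that by (auto simp: in_segment)
      then have "exp (y * ln q) \<in> closed_segment (exp 0) (exp (s * ln q))"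
        by (auto simp: closed_segment_eq_real_ivl split: if_splits)
      then show ?thesis
        using q by (auto simp: closed_segment_eq_real_ivl powr_def split: if_splits)
    qed
    moreover have "- Im t \<in> closed_segment 0 s"
      using that by (auto simp: closed_segment_eq_real_ivl split: if_splits)
    ultimately show ?thesis unfolding A_def mem_Collect_eq np by blast
  qed
  have pV: "p t \<in> V" if "Im t \<in> open_segment 0 (- s)" for t
  proof -
    have "min 1 (q powr s) < q powr y \<and> q powr y < max 1 (q powr s)" if "y \<in> open_segment 0 s" for y
    proof -
      have "y * ln q \<in> open_segment 0 (s * ln q)"
        using that q by (auto simp: in_segment)
      then have "exp (y * ln q) \<in> open_segment (exp 0) (exp (s * ln q))"
        by (auto simp: open_segment_eq_real_ivl split: if_splits)
      then show ?thesis
        using q by (auto simp: open_segment_eq_real_ivl powr_def split: if_splits)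
    qed
    moreover have "- Im t \<in> open_segment 0 s"
      using that by (auto simp: open_segment_eq_real_ivl split: if_splits)
    ultimately show ?thesis unfolding V_def Int_iff mem_Collect_eq np by blast
  qed
  show ?thesis
    unfolding continues_to_def
  proof (intro exI[of _ "\<lambda>t. S (p t)"] conjI allI)
    have pc: "continuous_on X p" "p holomorphic_on X" for X
      unfolding p by (intro continuous_intros holomorphic_intros)+
    show "continuous_on {t. Im t \<in> closed_segment 0 (- s)} (\<lambda>t. S (p t))"
      by (rule continuous_on_compose2[OF Scont pc(1)]) (use pA in auto)
    show "(\<lambda>t. S (p t)) holomorphic_on {t. Im t \<in> open_segment 0 (- s)}"
      by (rule holomorphic_on_compose_gen[OF pc(2) ShV, unfolded o_def]) (use pV in auto)
    show "S (p (of_real t)) = f (of_real q powr (\<i> * of_real t) * z)" for t :: real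
    proof -
      have "norm (p (of_real t)) = 1" unfolding np using q by simp
      then show ?thesis unfolding S_def using f infsumI by (fastforce simp: p_def)
    qed
    have "p (- \<i> * of_real s) = of_real (q powr s)"
      using q by (simp add: p powr_def exp_of_real[symmetric])
    then show "S (p (- \<i> * of_real s)) = w" using w by (simp add: S_def infsumI)
  qed
qed

text \<open>Since q^(it) z never vanishes, h composed with it is an entire function of t, and the
  continuation exists for every s.\<close>

lemma continues_to_holomorphic:
  assumes q: "0 < q" and h: "h holomorphic_on - {0}" and z: "z \<noteq> 0"
    and eq: "\<And>w. norm w = norm z \<Longrightarrow> h w = f w"
  shows "continues_to q s f z (h (of_real (q powr s) * z))"
  unfolding continues_to_def
proof (intro exI[of _ "\<lambda>t. h (exp (\<i> * t * of_real (ln q)) * z)"] conjI allI)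
  have *: "(\<lambda>t. h (exp (\<i> * t * of_real (ln q)) * z)) holomorphic_on X" for X
    using z by (intro holomorphic_on_compose_gen[OF _ h, unfolded o_def] holomorphic_intros) auto
  then show "(\<lambda>t. h (exp (\<i> * t * of_real (ln q)) * z)) holomorphic_on {t. Im t \<in> open_segment 0 (- s)}"
    "continuous_on {t. Im t \<in> closed_segment 0 (- s)} (\<lambda>t. h (exp (\<i> * t * of_real (ln q)) * z))"
    by (auto intro: holomorphic_on_imp_continuous_on)
  show "h (exp (\<i> * of_real t * of_real (ln q)) * z) = f (of_real q powr (\<i> * of_real t) * z)" for t :: real
    using q by (subst eq) (auto simp: norm_mult powr_def Ln_of_real)
  show "h (exp (\<i> * (- \<i> * of_real s) * of_real (ln q)) * z) = h (of_real (q powr s) * z)"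
    using q by (simp add: powr_def exp_of_real[symmetric])
qed

section \<open>Sums over the integers\<close>

lemma has_sum_int_symmetric:
  fixes f :: "int \<Rightarrow> 'a::{topological_comm_monoid_add,t2_space}"
  assumes "(f has_sum S) UNIV"
  shows "(\<lambda>M. \<Sum>n\<in>{- int M..int M}. f n) \<longlonglongrightarrow> S"
proof -
  have "filterlim (\<lambda>M. {- int M..int M}) (finite_subsets_at_top UNIV) sequentially"
    unfolding filterlim_finite_subsets_at_top
  proof (intro allI impI)
    fix X :: "int set" assume "finite X \<and> X \<subseteq> UNIV"
    then obtain b where b: "\<And>x. x \<in> X \<Longrightarrow> \<bar>x\<bar> \<le> b"
      using bdd_above_finite[of "abs ` X"] by (auto simp: bdd_above_def)
    show "\<forall>\<^sub>F M in sequentially. finite {- int M..int M} \<and> X \<subseteq> {- int M..int M} \<and> {- int M..int M} \<subseteq> UNIV"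
      using eventually_ge_at_top[of "nat b"]
    proof eventually_elim
      case (elim M)
      have "- int M \<le> x \<and> x \<le> int M" if "x \<in> X" for x using b[OF that] elim by linarith
      then show ?case by auto
    qed
  qed
  with assms show ?thesis unfolding has_sum_def by (rule filterlim_compose)
qed

text \<open>Only the differences d are assumed summable; for c the decay at both ends is enough,
  because the sum over -M, ..., M collapses to two boundary values.\<close>

lemma has_sum_telescope_int:
  fixes c d :: "int \<Rightarrow> 'a::{topological_ab_group_add,t2_space}"
  assumes d: "(d has_sum S) UNIV" and eq: "\<And>n. d n = c (n - 1) - c n"
    and c: "(\<lambda>k. c (int k)) \<longlonglongrightarrow> 0" "(\<lambda>k. c (- int k)) \<longlonglongrightarrow> 0"
  shows "S = 0"
proof -
  have sum: "(\<Sum>n\<in>{- int M..int M}. d n) = c (- int (Suc M)) - c (int M)" for M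
  proof (induction M)
    case 0
    then show ?case by (simp add: eq)
  next
    case (Suc M)
    have "{- int (Suc M)..int (Suc M)} = insert (- int (Suc M)) (insert (int (Suc M)) {- int M..int M})"
      by auto
    then have "(\<Sum>n\<in>{- int (Suc M)..int (Suc M)}. d n) = d (- int (Suc M)) + (d (int (Suc M)) + (\<Sum>n\<in>{- int M..int M}. d n))"
      by (simp only:) (subst sum.insert, simp, simp, subst sum.insert, auto)
    then show ?case unfolding Suc by (simp only: eq) (simp add: algebra_simps)
  qed
  have "(\<lambda>M. c (- int (Suc M)) - c (int M)) \<longlonglongrightarrow> 0 - 0"
    by (intro tendsto_diff c) (rule LIMSEQ_Suc[OF c(2)])
  then show ?thesis
    using has_sum_int_symmetric[OF d] unfolding sum by (simp add: LIMSEQ_unique)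
qed

section \<open>Integration against \<open>mu\<close>, circle by circle\<close>

context unit_base
begin

text \<open>\<open>mu q\<close> is an image of a weighted product of counting and Lebesgue measure,
  so Fubini evaluates the integral. Integrability over the counting measure is absolute summability
  of the circle contributions, hence an unordered sum.\<close>

lemma has_sum_integral_mu:
  fixes f :: "complex \<Rightarrow> 'a::euclidean_space"
  assumes f: "integrable (mu q) f" and cont: "\<And>n. continuous_on (sphere 0 (q powi n)) f"
  shows "((\<lambda>n. (q powi (2 * n)) *\<^sub>R circle_mean (q powi n) f) has_sum (\<integral>z. f z \<partial>mu q)) UNIV"
proof -
  let ?N = "restrict_space lborel {0..2 * pi}"
  let ?C = "count_space (UNIV :: int set)"
  let ?M = "?C \<Otimes>\<^sub>M ?N"
  let ?T = "\<lambda>(k::int, \<phi>). complex_of_real (q powi k) * cis \<phi>"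
  let ?d = "\<lambda>(k::int, \<phi>::real). q powi (2 * k) / (2 * pi)"
  have cis: "cis \<in> borel_measurable borel"
    by (intro borel_measurable_continuous_onI continuous_intros)
  have N: "(\<lambda>x. x) \<in> ?N \<rightarrow>\<^sub>M borel" by (simp add: measurable_restrict_space1)
  have T: "?T \<in> ?M \<rightarrow>\<^sub>M restrict_space borel (Gam_bar q)"
  proof (rule measurable_restrict_space2)
    show "?T \<in> space ?M \<rightarrow> Gam_bar q"
      by (auto simp: Gam_bar_def Gam_def norm_mult norm_power_int)
    have "(\<lambda>x. complex_of_real (q powi fst x)) \<in> borel_measurable ?M"
      by (rule measurable_compose[OF measurable_fst]) simp
    moreover have "(\<lambda>x. cis (snd x)) \<in> borel_measurable ?M"
      by (rule measurable_compose[OF measurable_compose[OF measurable_snd N] cis])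
    ultimately show "?T \<in> borel_measurable ?M"
      unfolding case_prod_unfold by (rule borel_measurable_times)
  qed
  have d: "?d \<in> borel_measurable ?M"
    unfolding case_prod_unfold by (rule measurable_compose[OF measurable_fst]) simp
  have d0: "AE x in ?M. 0 \<le> ?d x" by (auto intro!: AE_I2 simp: case_prod_unfold)
  have mu: "mu q = distr (density ?M (\<lambda>x. ennreal (?d x))) (restrict_space borel (Gam_bar q)) ?T"
    by (simp add: mu_def case_prod_unfold)
  have T': "?T \<in> density ?M (\<lambda>x. ennreal (?d x)) \<rightarrow>\<^sub>M restrict_space borel (Gam_bar q)"
    using T by (simp only: measurable_density_eq1)
  have fm: "f \<in> borel_measurable (restrict_space borel (Gam_bar q))"
    using borel_measurable_integrable[OF f] unfolding mu by simp
  have fT: "(\<lambda>x. f (?T x)) \<in> borel_measurable ?M" by (rule measurable_compose[OF T fm])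
  have "integrable (density ?M (\<lambda>x. ennreal (?d x))) (\<lambda>x. f (?T x))"
    using f unfolding mu by (subst (asm) integrable_distr_eq[OF T' fm])
  then have int: "integrable ?M (\<lambda>x. ?d x *\<^sub>R f (?T x))"
    by (subst (asm) integrable_density[OF fT d d0])
  have "(\<integral>z. f z \<partial>mu q) = (\<integral>x. f (?T x) \<partial>density ?M (\<lambda>x. ennreal (?d x)))"
    unfolding mu by (rule integral_distr[OF T' fm])
  also have "\<dots> = (\<integral>x. ?d x *\<^sub>R f (?T x) \<partial>?M)" by (rule integral_density[OF fT d d0])
  finally have eq: "(\<integral>z. f z \<partial>mu q) = (\<integral>x. ?d x *\<^sub>R f (?T x) \<partial>?M)" .
  interpret N: sigma_finite_measure ?N
    by (rule sigma_finite_measure_restrict_space) (simp_all add: lborel.sigma_finite_measure_axioms)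
  interpret C: sigma_finite_measure ?C
    by (rule sigma_finite_measure_count_space)
  interpret P: pair_sigma_finite ?C ?N ..
  have inner: "(\<integral>\<phi>. ?d (k, \<phi>) *\<^sub>R f (?T (k, \<phi>)) \<partial>?N) = (q powi (2 * k)) *\<^sub>R circle_mean (q powi k) f" for k
  proof -
    let ?g = "\<lambda>\<phi>. f (of_real (q powi k) * cis \<phi>)"
    have "(\<integral>\<phi>. ?d (k, \<phi>) *\<^sub>R f (?T (k, \<phi>)) \<partial>?N) = (q powi (2 * k) / (2 * pi)) *\<^sub>R (\<integral>\<phi>. ?g \<phi> \<partial>?N)"
      by simp
    also have "(\<integral>\<phi>. ?g \<phi> \<partial>?N) = (LINT \<phi>:{0..2 * pi}|lborel. ?g \<phi>)"
      unfolding set_lebesgue_integral_def by (rule integral_restrict_space) simp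
    also have "\<dots> = integral {0..2 * pi} ?g"
    proof (rule set_borel_integral_eq_integral(2))
      have "continuous_on {0..2 * pi} ?g" by (rule continuous_on_circle[OF powi_nonneg cont])
      then show "set_integrable lborel {0..2 * pi} ?g" by (rule borel_integrable_atLeastAtMost')
    qed
    finally show ?thesis by (simp only: circle_mean_def divide_inverse scaleR_scaleR)
  qed
  define g where "g = (\<lambda>k. (q powi (2 * k)) *\<^sub>R circle_mean (q powi k) f)"
  have I: "integrable ?C g"
    using P.integrable_fst'[OF int] unfolding inner g_def .
  have E: "(\<integral>z. f z \<partial>mu q) = (\<integral>k. g k \<partial>?C)"
    unfolding eq g_def using P.integral_fst'[OF int] unfolding inner by (rule sym)
  have S: "(\<lambda>n. norm (g n)) summable_on UNIV"
    using I abs_summable_equivalent[of g UNIV] by (simp add: abs_summable_on_def)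
  have "(\<integral>z. f z \<partial>mu q) = (\<Sum>\<^sub>\<infinity>k. g k)"
    unfolding E using infsetsum_infsum[of g UNIV] I by (simp add: abs_summable_on_def infsetsum_def)
  then have "(g has_sum (\<integral>z. f z \<partial>mu q)) UNIV"
    using S by (metis abs_summable_summable has_sum_infsum)
  then show "((\<lambda>n. (q powi (2 * n)) *\<^sub>R circle_mean (q powi n) f) has_sum (\<integral>z. f z \<partial>mu q)) UNIV"
    unfolding g_def .
qed

end

lemma has_sum_shift_int:
  fixes f :: "int \<Rightarrow> 'a::{topological_comm_monoid_add,t2_space}"
  shows "(f has_sum S) UNIV \<Longrightarrow> ((\<lambda>n. f (n + k)) has_sum S) UNIV"
  by (subst has_sum_reindex_bij_witness[of UNIV "\<lambda>n. n - k" "\<lambda>n. n + k" UNIV f _ S S]) auto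

lemma summable_on_shift_int:
  fixes f :: "int \<Rightarrow> 'a::{topological_comm_monoid_add,t2_space}"
  shows "f summable_on UNIV \<Longrightarrow> (\<lambda>n. f (n + k)) summable_on UNIV"
  using has_sum_shift_int unfolding summable_on_def by blast

context unit_base
begin

section \<open>The Fourier transform as a series of circle means\<close>

definition circle_continuous :: "(complex \<Rightarrow> complex) \<Rightarrow> bool" where
  "circle_continuous g \<longleftrightarrow> (\<forall>n. continuous_on (sphere 0 (q powi n)) g)"

text \<open>The index m is kept apart from \<zeta>, so that \<zeta> can leave the circle of radius
  q^m while the kernel is still the function continued from the circle of index m + n.\<close>

definition Fourier_term :: "int \<Rightarrow> complex \<Rightarrow> (complex \<Rightarrow> complex) \<Rightarrow> int \<Rightarrow> complex" where
  "Fourier_term m \<zeta> g n = of_real (q powi (2 * n)) * circle_mean (q powi n) (\<lambda>z. Fq_ext q (m + n) (\<zeta> * z) * g z)"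

text \<open>The contribution of the circle of radius q^n to the integral of |g|; it dominates
  \<open>Fourier_term\<close> as long as |\<zeta>| = q^m.\<close>

definition norm_term :: "(complex \<Rightarrow> complex) \<Rightarrow> int \<Rightarrow> real" where
  "norm_term g n = q powi (2 * n) * circle_mean (q powi n) (\<lambda>z. norm (g z))"

lemma norm_mult_powi: "norm (\<zeta>::complex) = q powi m \<Longrightarrow> norm z = q powi n \<Longrightarrow> norm (\<zeta> * z) = q powi (m + n)"
  by (simp add: norm_mult powi_add)

lemma Gam_bar_mult: "a \<in> Gam_bar q \<Longrightarrow> b \<in> Gam_bar q \<Longrightarrow> a * b \<in> Gam_bar q"
  unfolding Gam_bar_def Gam_def using norm_mult_powi by fastforce

lemma Gam_subset: "Gam q \<subseteq> Gam_bar q"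
  by (auto simp: Gam_bar_def)

lemma space_mu: "space (mu q) = Gam_bar q" and sets_mu: "sets (mu q) = sets (restrict_space borel (Gam_bar q))"
  by (simp_all add: mu_def space_restrict_space)

lemma Fq_measurable:
  assumes "\<zeta> \<in> Gam_bar q"
  shows "(\<lambda>z. Fq q (\<zeta> * z)) \<in> borel_measurable (mu q)"
proof -
  have "continuous_on (Gam_bar q) (\<lambda>z. Fq q (\<zeta> * z))"
    by (intro continuous_on_compose2[OF continuous_Fq] continuous_intros) (use assms Gam_bar_mult in auto)
  then have "(\<lambda>z. Fq q (\<zeta> * z)) \<in> borel_measurable (restrict_space borel (Gam_bar q))"
    by (rule borel_measurable_continuous_on_restrict)
  then show ?thesis by (simp cong: measurable_cong_sets add: sets_mu)
qed

lemma Fourier_integrable: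
  assumes g: "integrable (mu q) g" and \<zeta>: "\<zeta> \<in> Gam_bar q"
  shows "integrable (mu q) (\<lambda>z. Fq q (\<zeta> * z) * g z)"
proof (rule Bochner_Integration.integrable_bound[OF g])
  show "(\<lambda>z. Fq q (\<zeta> * z) * g z) \<in> borel_measurable (mu q)"
    using Fq_measurable[OF \<zeta>] borel_measurable_integrable[OF g] by (rule borel_measurable_times)
  show "AE z in mu q. norm (Fq q (\<zeta> * z) * g z) \<le> norm (g z)"
    using \<zeta> by (auto intro!: AE_I2 simp: norm_mult norm_Fq Gam_bar_mult space_mu)
qed

text \<open>Dominated convergence with majorant |g|. It carries the relations proved on
  \<open>Gam q\<close> over to the point 0.\<close>

lemma Fourier_tendsto_0:
  assumes g: "integrable (mu q) g"
  shows "(Fourier q g \<longlongrightarrow> Fourier q g 0) (at 0 within Gam q)"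
  unfolding tendsto_at_iff_sequentially
proof (intro allI impI)
  fix X :: "nat \<Rightarrow> complex" assume X: "\<forall>i. X i \<in> Gam q - {0}" and lim: "X \<longlonglongrightarrow> 0"
  have XG: "X i \<in> Gam_bar q" for i using X Gam_subset by blast
  have 0: "0 \<in> Gam_bar q" by (simp add: Gam_bar_def)
  have "(\<lambda>i. \<integral>z. Fq q (X i * z) * g z \<partial>mu q) \<longlonglongrightarrow> (\<integral>z. Fq q (0 * z) * g z \<partial>mu q)"
  proof (rule integral_dominated_convergence)
    show "(\<lambda>z. Fq q (0 * z) * g z) \<in> borel_measurable (mu q)" "(\<lambda>z. Fq q (X i * z) * g z) \<in> borel_measurable (mu q)" for i
      by (rule borel_measurable_integrable, rule Fourier_integrable[OF g], rule 0 XG)+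
    show "integrable (mu q) (\<lambda>z. norm (g z))" using g by simp
    show "AE z in mu q. norm (Fq q (X i * z) * g z) \<le> norm (g z)" for i
      using XG by (auto intro!: AE_I2 simp: norm_mult norm_Fq Gam_bar_mult space_mu)
    show "AE z in mu q. (\<lambda>i. Fq q (X i * z) * g z) \<longlonglongrightarrow> Fq q (0 * z) * g z"
    proof (intro AE_I2)
      fix z
      have "isCont (Fq q) 0" using Fq_tendsto_0 by (simp add: isCont_def Fq_0)
      moreover have "(\<lambda>i. X i * z) \<longlonglongrightarrow> 0 * z" by (intro tendsto_intros lim)
      ultimately have "(\<lambda>i. Fq q (X i * z)) \<longlonglongrightarrow> Fq q (0 * z)"
        by (metis isCont_tendsto_compose mult_zero_left)
      then show "(\<lambda>i. Fq q (X i * z) * g z) \<longlonglongrightarrow> Fq q (0 * z) * g z" by (intro tendsto_intros)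
    qed
  qed
  then show "(Fourier q g \<circ> X) \<longlonglongrightarrow> Fourier q g 0" by (simp add: Fourier_def o_def)
qed

lemma nontrivial_at_0: "at 0 within Gam q \<noteq> bot"
proof -
  have "(\<lambda>k. of_real (q powi int k)) \<longlonglongrightarrow> complex_of_real 0"
    using q_pos q_less_1 by (intro tendsto_of_real) (simp add: LIMSEQ_realpow_zero)
  moreover have "complex_of_real (q powi int k) \<in> Gam q - {0}" for k
    by (auto simp: Gam_def norm_power intro!: exI[of _ "int k"])
  ultimately have "0 islimpt Gam q" unfolding islimpt_sequential by (metis of_real_0)
  then show ?thesis by (simp add: trivial_limit_within)
qed

lemma Fq_ext_holomorphic_mult:
  assumes "\<zeta> \<noteq> 0"
  shows "(\<lambda>z. Fq_ext q N (\<zeta> * z)) holomorphic_on ball 0 (Fq_ext_radius N / norm \<zeta>) - {0}"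
proof (rule holomorphic_on_compose_gen[OF _ Fq_ext_holomorphic, unfolded o_def])
  show "(*) \<zeta> holomorphic_on ball 0 (Fq_ext_radius N / norm \<zeta>) - {0}" by (intro holomorphic_intros)
  show "(*) \<zeta> ` (ball 0 (Fq_ext_radius N / norm \<zeta>) - {0}) \<subseteq> ball 0 (Fq_ext_radius N) - {0}"
    using assms by (auto simp: norm_mult field_simps)
qed

lemma Fq_ext_mult_continuous:
  assumes "norm \<zeta> = q powi j" "j + n \<ge> N"
  shows "continuous_on (sphere 0 (q powi n)) (\<lambda>z. Fq_ext q N (\<zeta> * z))"
proof (rule continuous_on_compose2[OF Fq_ext_continuous_sphere[OF assms(2)]])
  show "(*) \<zeta> ` sphere 0 (q powi n) \<subseteq> sphere 0 (q powi (j + n))"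
    using norm_mult_powi[OF assms(1)] by auto
qed (intro continuous_intros)

lemma circle_continuousD: "circle_continuous g \<Longrightarrow> continuous_on (sphere 0 (q powi n)) g"
  by (simp add: circle_continuous_def)

lemma nz_circle: "norm z = q powi n \<Longrightarrow> z \<noteq> 0"
  using powi_pos[of n] by auto

lemma kernel_continuous:
  "circle_continuous g \<Longrightarrow> norm \<zeta> = q powi j \<Longrightarrow> j + n \<ge> N \<Longrightarrow>
    continuous_on (sphere 0 (q powi n)) (\<lambda>z. Fq_ext q N (\<zeta> * z) * g z)"
  by (intro continuous_on_mult Fq_ext_mult_continuous circle_continuousD)

lemma circle_mean_kernel_add:
  assumes "circle_continuous g" "circle_continuous h" "norm \<zeta> = q powi j" "j + n \<ge> N"
  shows "circle_mean (q powi n) (\<lambda>z. Fq_ext q N (\<zeta> * z) * g z + c * (Fq_ext q N (\<zeta> * z) * h z))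
    = circle_mean (q powi n) (\<lambda>z. Fq_ext q N (\<zeta> * z) * g z) + c * circle_mean (q powi n) (\<lambda>z. Fq_ext q N (\<zeta> * z) * h z)"
  unfolding circle_mean_cmult[symmetric]
  by (rule circle_mean_add[OF powi_nonneg kernel_continuous[OF assms(1,3,4)]
        continuous_on_mult_left[OF kernel_continuous[OF assms(2,3,4)]]])

lemma circle_continuous_divide: "circle_continuous g \<Longrightarrow> circle_continuous (\<lambda>z. g z / z)"
  "circle_continuous g \<Longrightarrow> circle_continuous (\<lambda>z. g z / cnj z)"
  unfolding circle_continuous_def using nz_circle by (auto intro!: continuous_intros)

lemma circle_continuous_Zop: "circle_continuous g \<Longrightarrow> circle_continuous (Zop g)" "circle_continuous g \<Longrightarrow> circle_continuous (Zop_star g)"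
  unfolding circle_continuous_def Zop_def Zop_star_def by (auto intro!: continuous_intros)

lemma integrable_Zop_iff:
  assumes "g \<in> borel_measurable (mu q)"
  shows "integrable (mu q) (Zop g) \<longleftrightarrow> integrable (mu q) (Zop_star g)"
proof -
  have m: "h \<in> borel_measurable (mu q)" if "continuous_on (Gam_bar q) h" for h :: "complex \<Rightarrow> complex"
    using borel_measurable_continuous_on_restrict[OF that] by (simp cong: measurable_cong_sets add: sets_mu)
  have M: "Zop g \<in> borel_measurable (mu q)" "Zop_star g \<in> borel_measurable (mu q)"
    unfolding Zop_def[abs_def] Zop_star_def[abs_def]
    by (intro borel_measurable_times m assms continuous_intros)+
  show ?thesis
  proof
    assume "integrable (mu q) (Zop g)"
    from Bochner_Integration.integrable_bound[OF this M(2)] show "integrable (mu q) (Zop_star g)"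
      by (simp add: Zop_def Zop_star_def norm_mult)
  next
    assume "integrable (mu q) (Zop_star g)"
    from Bochner_Integration.integrable_bound[OF this M(1)] show "integrable (mu q) (Zop g)"
      by (simp add: Zop_def Zop_star_def norm_mult)
  qed
qed

lemma Fourier_has_sum:
  assumes g: "integrable (mu q) g" "circle_continuous g" and \<zeta>: "norm \<zeta> = q powi m"
  shows "(Fourier_term m \<zeta> g has_sum Fourier q g \<zeta>) UNIV"
proof -
  have \<zeta>G: "\<zeta> \<in> Gam_bar q" using \<zeta> by (auto simp: Gam_bar_def Gam_def)
  have K: "Fq q (\<zeta> * z) = Fq_ext q (m + n) (\<zeta> * z)" if "norm z = q powi n" for z n
    by (rule Fq_eq_Fq_ext[OF norm_mult_powi[OF \<zeta> that]])
  have "continuous_on (sphere 0 (q powi n)) (\<lambda>z. Fq q (\<zeta> * z) * g z)" for n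
  proof -
    have "continuous_on (sphere 0 (q powi n)) (\<lambda>z. Fq_ext q (m + n) (\<zeta> * z) * g z)"
      by (intro continuous_intros Fq_ext_mult_continuous[OF \<zeta>] circle_continuousD g) simp
    then show ?thesis by (rule continuous_on_eq) (simp add: K)
  qed
  from has_sum_integral_mu[OF Fourier_integrable[OF g(1) \<zeta>G] this]
  have "((\<lambda>n. (q powi (2 * n)) *\<^sub>R circle_mean (q powi n) (\<lambda>z. Fq q (\<zeta> * z) * g z)) has_sum Fourier q g \<zeta>) UNIV"
    by (simp only: Fourier_def)
  moreover have "(q powi (2 * n)) *\<^sub>R circle_mean (q powi n) (\<lambda>z. Fq q (\<zeta> * z) * g z) = Fourier_term m \<zeta> g n" for n
  proof -
    have "circle_mean (q powi n) (\<lambda>z. Fq q (\<zeta> * z) * g z) = circle_mean (q powi n) (\<lambda>z. Fq_ext q (m + n) (\<zeta> * z) * g z)"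
      by (intro circle_mean_cong) (simp_all add: K)
    then show ?thesis by (simp only: Fourier_term_def scaleR_conv_of_real)
  qed
  ultimately show ?thesis by (simp only:)
qed

lemma norm_term_nonneg: "circle_continuous g \<Longrightarrow> norm_term g n \<ge> 0"
  unfolding norm_term_def by (intro mult_nonneg_nonneg circle_mean_nonneg powi_nonneg continuous_intros circle_continuousD) auto

lemma norm_term_summable:
  assumes g: "integrable (mu q) g" "circle_continuous g"
  shows "norm_term g summable_on UNIV"
proof -
  have "((\<lambda>n. (q powi (2 * n)) *\<^sub>R circle_mean (q powi n) (\<lambda>z. norm (g z))) has_sum (\<integral>z. norm (g z) \<partial>mu q)) UNIV"
    using g by (intro has_sum_integral_mu) (auto intro!: continuous_intros circle_continuousD)
  then show ?thesis unfolding norm_term_def[abs_def] real_scaleR_def by (rule has_sum_imp_summable)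
qed

lemma norm_Fourier_term_le:
  assumes g: "circle_continuous g" and \<zeta>: "norm \<zeta> = q powi m"
  shows "norm (Fourier_term m \<zeta> g n) \<le> norm_term g n"
proof -
  have "norm (circle_mean (q powi n) (\<lambda>z. Fq_ext q (m + n) (\<zeta> * z) * g z)) \<le> circle_mean (q powi n) (\<lambda>z. norm (g z))"
    by (intro norm_circle_mean_le powi_nonneg continuous_intros Fq_ext_mult_continuous[OF \<zeta>] circle_continuousD g)
       (simp_all add: norm_mult norm_Fq_ext[OF norm_mult_powi[OF \<zeta>]])
  then show ?thesis
    unfolding Fourier_term_def norm_term_def norm_mult norm_of_real abs_of_pos[OF powi_pos]
    by (rule mult_left_mono) simp
qed

text \<open>Here \<xi> lies one circle inside the one belonging to index m.
  \<open>Fq_ext_rec\<close> rewrites the continued kernel through the kernel of the circle on which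
  \<xi> really lies, so both resulting terms are dominated by \<open>norm_term\<close>.\<close>

lemma Fourier_term_down:
  assumes g: "circle_continuous g" and \<xi>: "norm \<xi> = q powi (m + 1)"
  shows "Fourier_term m \<xi> g n = Fourier_term (m + 1) \<xi> g n + of_real (q powi (-2)) * cnj \<xi> * Fourier_term (m + 1) \<xi> (Zop_star g) n"
proof -
  have "circle_mean (q powi n) (\<lambda>z. Fq_ext q (m + n) (\<xi> * z) * g z)
      = circle_mean (q powi n) (\<lambda>z. Fq_ext q (m + 1 + n) (\<xi> * z) * g z
          + (of_real (q powi (-2)) * cnj \<xi>) * (Fq_ext q (m + 1 + n) (\<xi> * z) * Zop_star g z))"
  proof (intro circle_mean_cong powi_nonneg)
    fix z :: complex assume z: "norm z = q powi n"
    have "Fq_ext q (m + n) (\<xi> * z) = (1 + of_real (q powi (-2)) * cnj (\<xi> * z)) * Fq_ext q (m + 1 + n) (\<xi> * z)"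
      using Fq_ext_rec[OF norm_mult_powi[OF \<xi> z]] by simp
    then show "Fq_ext q (m + n) (\<xi> * z) * g z = Fq_ext q (m + 1 + n) (\<xi> * z) * g z
          + (of_real (q powi (-2)) * cnj \<xi>) * (Fq_ext q (m + 1 + n) (\<xi> * z) * Zop_star g z)"
      unfolding Zop_star_def by (simp only: complex_cnj_mult) (simp only: ring_distribs mult_1 mult_ac)
  qed
  also have "\<dots> = circle_mean (q powi n) (\<lambda>z. Fq_ext q (m + 1 + n) (\<xi> * z) * g z)
     + (of_real (q powi (-2)) * cnj \<xi>) * circle_mean (q powi n) (\<lambda>z. Fq_ext q (m + 1 + n) (\<xi> * z) * Zop_star g z)"
    by (rule circle_mean_kernel_add[OF g circle_continuous_Zop(2)[OF g] \<xi>]) simp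
  finally show ?thesis unfolding Fourier_term_def by (simp only: ring_distribs mult_ac)
qed

text \<open>Again the point lies one circle inside that of its index, but
  \<open>Fq_ext_scale\<close> expresses the term at the point \<zeta>, two circles further out,
  instead of at the point itself.\<close>

lemma Fourier_term_up:
  assumes g: "circle_continuous g" and \<zeta>: "norm \<zeta> = q powi m"
  shows "Fourier_term (m + 1) (of_real (q ^ 2) * \<zeta>) g n = Fourier_term m \<zeta> g n + \<zeta> * Fourier_term m \<zeta> (Zop g) n"
proof -
  have "circle_mean (q powi n) (\<lambda>z. Fq_ext q (m + 1 + n) (of_real (q ^ 2) * \<zeta> * z) * g z)
      = circle_mean (q powi n) (\<lambda>z. Fq_ext q (m + n) (\<zeta> * z) * g z + \<zeta> * (Fq_ext q (m + n) (\<zeta> * z) * Zop g z))"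
  proof (intro circle_mean_cong powi_nonneg)
    fix z :: complex assume z: "norm z = q powi n"
    have "Fq_ext q (m + 1 + n) (of_real (q ^ 2) * (\<zeta> * z)) = (1 + \<zeta> * z) * Fq_ext q (m + n) (\<zeta> * z)"
      using Fq_ext_scale[of "\<zeta> * z" "m + 1 + n"] norm_mult_powi[OF \<zeta> z] by simp
    then show "Fq_ext q (m + 1 + n) (of_real (q ^ 2) * \<zeta> * z) * g z
        = Fq_ext q (m + n) (\<zeta> * z) * g z + \<zeta> * (Fq_ext q (m + n) (\<zeta> * z) * Zop g z)"
      unfolding Zop_def by (simp only: mult.assoc) (simp only: ring_distribs mult_1 mult_ac)
  qed
  also have "\<dots> = circle_mean (q powi n) (\<lambda>z. Fq_ext q (m + n) (\<zeta> * z) * g z)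
     + \<zeta> * circle_mean (q powi n) (\<lambda>z. Fq_ext q (m + n) (\<zeta> * z) * Zop g z)"
    by (rule circle_mean_kernel_add[OF g circle_continuous_Zop(1)[OF g] \<zeta>]) simp
  finally show ?thesis unfolding Fourier_term_def by (simp only: ring_distribs mult_ac)
qed

text \<open>The variable x multiplies \<zeta> inside the kernel, which is holomorphic inwards. The
  value v is left open because the series at q \<zeta> is summed in two ways, by
  \<open>Fourier_term_down\<close> and by \<open>Fourier_term_up\<close>.\<close>

lemma Fourier_continues_inward:
  assumes g: "integrable (mu q) g" "circle_continuous g" and Zg: "integrable (mu q) (Zop_star g)"
    and \<zeta>: "norm \<zeta> = q powi m" and v: "(Fourier_term m (of_real q * \<zeta>) g has_sum v) UNIV"
  shows "continues_to q 1 (Fourier q g) \<zeta> v"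
proof -
  have \<zeta>0: "\<zeta> \<noteq> 0" by (rule nz_circle[OF \<zeta>])
  define H where "H = (\<lambda>n x. Fourier_term m (x * \<zeta>) g n)"
  define B where "B = (\<lambda>n. norm_term g n + q powi (-2) * q powi (m + 1) * norm_term (Zop_star g) n)"
  note Zc = circle_continuous_Zop(2)[OF g(2)]
  have nB: "norm_term g n \<le> B n" for n
    unfolding B_def using norm_term_nonneg[OF Zc, of n] by simp
  show ?thesis
  proof (rule continues_to_series[where H = H and B = B and U = "\<lambda>n. ball 0 (Fq_ext_radius (m + n) / q powi (m + n)) - {0}"])
    show "H n holomorphic_on ball 0 (Fq_ext_radius (m + n) / q powi (m + n)) - {0}" for n
    proof -
      have "(\<lambda>x. circle_mean (q powi n) (\<lambda>z. Fq_ext q (m + n) (\<zeta> * (x * z)) * g z)) holomorphic_on ball 0 (Fq_ext_radius (m + n) / q powi (m + n)) - {0}"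
      proof (rule circle_mean_holomorphic[OF Fq_ext_holomorphic_mult[OF \<zeta>0]])
        fix x z :: complex assume x: "x \<in> ball 0 (Fq_ext_radius (m + n) / q powi (m + n)) - {0}" and z: "norm z = q powi n"
        have "norm x < Fq_ext_radius (m + n) / q powi (m + n)" using x by simp
        then have "norm x * q powi n < Fq_ext_radius (m + n) / norm \<zeta>"
          unfolding \<zeta> powi_add by (simp add: field_simps)
        then show "x * z \<in> ball 0 (Fq_ext_radius (m + n) / norm \<zeta>) - {0}"
          using x nz_circle[OF z] z by (simp add: norm_mult)
      qed (auto intro!: open_Diff circle_continuousD g)
      then show ?thesis unfolding H_def Fourier_term_def by (intro holomorphic_intros) (simp add: mult_ac)
    qed
    show "open (ball 0 (Fq_ext_radius (m + n) / q powi (m + n)) - {0::complex})" for n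
      by (intro open_Diff) auto
    show "x \<in> ball 0 (Fq_ext_radius (m + n) / q powi (m + n)) - {0}"
      if "min 1 (q powr 1) \<le> norm x" "norm x \<le> max 1 (q powr 1)" for n and x :: complex
    proof -
      have "0 < norm x" "norm x \<le> 1" using that q_pos q_less_1 by (auto simp: min_def max_def split: if_splits)
      moreover have "1 < Fq_ext_radius (m + n) / q powi (m + n)" using Fq_ext_radius_gt[of "m + n"] by simp
      ultimately have "0 < norm x" "norm x < Fq_ext_radius (m + n) / q powi (m + n)" by linarith+
      then show ?thesis by simp
    qed
    show "norm (H n x) \<le> B n" if "norm x = 1 \<or> norm x = q powr 1" for n x
      using that
    proof
      assume "norm x = 1"
      then have "norm (x * \<zeta>) = q powi m" using \<zeta> by (simp add: norm_mult)
      then show ?thesis unfolding H_def using norm_Fourier_term_le[OF g(2)] nB order_trans by blast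
    next
      assume "norm x = q powr 1"
      then have x: "norm (x * \<zeta>) = q powi (m + 1)" using \<zeta> q_pos by (simp add: norm_mult powi_add)
      have "norm (H n x) \<le> norm (Fourier_term (m + 1) (x * \<zeta>) g n) + norm (of_real (q powi (-2)) * cnj (x * \<zeta>) * Fourier_term (m + 1) (x * \<zeta>) (Zop_star g) n)"
        unfolding H_def Fourier_term_down[OF g(2) x] by (rule norm_triangle_ineq)
      also have "norm (of_real (q powi (-2)) * cnj (x * \<zeta>) * Fourier_term (m + 1) (x * \<zeta>) (Zop_star g) n)
          = q powi (-2) * q powi (m + 1) * norm (Fourier_term (m + 1) (x * \<zeta>) (Zop_star g) n)"
        unfolding norm_mult[of "_ * _"] norm_mult[of "of_real _"] norm_of_real complex_mod_cnj x abs_of_pos[OF powi_pos] ..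
      also have "norm (Fourier_term (m + 1) (x * \<zeta>) g n) + \<dots> \<le> B n"
        unfolding B_def by (intro add_mono mult_left_mono norm_Fourier_term_le g Zc x mult_nonneg_nonneg powi_nonneg)
      finally show ?thesis by simp
    qed
    show "B summable_on UNIV"
      unfolding B_def by (intro summable_on_add summable_on_cmult_right norm_term_summable g Zg Zc)
    show "((\<lambda>n. H n x) has_sum Fourier q g (x * \<zeta>)) UNIV" if "norm x = 1" for x
      unfolding H_def by (rule Fourier_has_sum[OF g]) (simp add: norm_mult that \<zeta>)
    show "((\<lambda>n. H n (of_real (q powr 1))) has_sum v) UNIV"
      unfolding H_def using v q_pos by simp
  qed (use q_pos q_less_1 in auto)
qed

end

text \<open>\<open>F n\<close> is the continuation of \<open>f\<close> from the circle \<open>|z| = q\<^sup>n\<close>.\<close>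

locale q_function = unit_base +
  fixes f :: "complex \<Rightarrow> complex" and F :: "int \<Rightarrow> complex \<Rightarrow> complex"
  assumes f_integrable: "integrable (mu q) f" and f_cont: "continuous_on (Gam_bar q) f"
    and F_holomorphic: "\<And>n. F n holomorphic_on - {0}"
    and F_eq: "\<And>n z. norm z = q powi n \<Longrightarrow> F n z = f z"
begin

lemma powi_minus_2_mult: "complex_of_real (q powi (-2)) * of_real (q ^ 2) = 1"
proof -
  have "q powi (-2) * q ^ 2 = 1" by (simp add: power_int_minus)
  then show ?thesis by (metis of_real_1 of_real_mult)
qed

lemma f_circ: "circle_continuous f"
  unfolding circle_continuous_def using continuous_on_subset[OF f_cont sphere_subset_Gam_bar] by blast

section \<open>Contour shifts against the continuations of f\<close>

lemma F_comp_holomorphic: "c \<noteq> 0 \<Longrightarrow> (\<lambda>z. F k (c * z)) holomorphic_on - {0}"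
  by (intro holomorphic_on_compose_gen[OF _ F_holomorphic, unfolded o_def] holomorphic_intros) auto

lemma circle_continuous_holomorphic: "g holomorphic_on - {0} \<Longrightarrow> circle_continuous g"
  unfolding circle_continuous_def using nz_circle
  by (auto intro!: continuous_on_subset[OF holomorphic_on_imp_continuous_on])

text \<open>The first condition on the indices puts the starting circle inside the punctured disc of
  the kernel, and n \<le> k makes the move an inward one.\<close>

lemma mean_shift:
  assumes G: "G holomorphic_on - {0}" and \<xi>: "norm \<xi> = q powi j" and "j + n \<ge> N" "n \<le> k"
  shows "circle_mean (q powi n) (\<lambda>z. Fq_ext q N (\<xi> * z) * G z) = circle_mean (q powi k) (\<lambda>z. Fq_ext q N (\<xi> * z) * G z)"
proof (rule circle_mean_radius)
  show "(\<lambda>z. Fq_ext q N (\<xi> * z) * G z) holomorphic_on ball 0 (Fq_ext_radius N / norm \<xi>) - {0}"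
    by (intro holomorphic_on_mult Fq_ext_holomorphic_mult nz_circle[OF \<xi>] holomorphic_on_subset[OF G]) auto
  have "q powi j * q powi n \<le> q powi N" using assms(3) by (simp only: powi_add[symmetric] powi_le_iff)
  then have "q powi j * q powi n < Fq_ext_radius N" using Fq_ext_radius_gt[of N] by linarith
  then show *: "q powi n < Fq_ext_radius N / norm \<xi>" unfolding \<xi> by (simp add: field_simps)
  have "q powi k \<le> q powi n" using assms(4) by (simp only: powi_le_iff)
  then show "q powi k < Fq_ext_radius N / norm \<xi>" using * by linarith
qed auto

lemma mean_rescale: "circle_mean (q powi n) (\<lambda>z. g (of_real q * z)) = circle_mean (q powi (n + 1)) g"
  unfolding circle_mean_scale by (simp add: power_int_add mult.commute)

lemma dot_f:
  assumes "norm z = q powi n"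
  shows "dot q 1 f z = F n (of_real q * z)" "dot q (-1) f z = F n (of_real (inverse q) * z)"
proof -
  have *: "continues_to q s f z (F n (of_real (q powr s) * z))" for s
    by (rule continues_to_holomorphic[OF q_pos F_holomorphic nz_circle[OF assms]]) (simp add: assms F_eq)
  show "dot q 1 f z = F n (of_real q * z)" "dot q (-1) f z = F n (of_real (inverse q) * z)"
    using dot_eq[OF _ *[of 1]] dot_eq[OF _ *[of "-1"]] q_pos by (simp_all add: powr_minus)
qed

lemma norm_q_mult: "norm z = q powi n \<Longrightarrow> norm (of_real q * z) = q powi (n + 1)"
  "norm z = q powi n \<Longrightarrow> norm (of_real (inverse q) * z) = q powi (n - 1)" for z :: complex
  by (simp_all add: norm_mult power_int_add power_int_diff norm_inverse divide_inverse)

section \<open>Fourier transforms of derivatives\<close>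

lemma dR_f:
  assumes z: "norm z = q powi n"
  shows "dR q f z = (F (n - 1) (of_real (q powi (-2)) * z) - f z) / (of_real (q powi (-2) - 1) * z)"
proof -
  have "of_real (inverse q) * (of_real (inverse q) * z) = of_real (q powi (-2)) * z"
    by (simp add: power_int_def power2_eq_square)
  then show ?thesis
    unfolding dR_def extend0_def dot_f(2)[OF norm_q_mult(2)[OF z]] using nz_circle[OF z] by (simp only: if_False)
qed

text \<open>The scalings by q and 1/q cancel, but the continuation starts from the circle of index n
  + 1; this is why F (n + 1) z appears rather than f z.\<close>

lemma dR_bar_f:
  assumes z: "norm z = q powi n"
  shows "dR_bar q f z = (f z - F (n + 1) z) / (of_real (1 - q ^ 2) * cnj z)"
proof -
  have "of_real (inverse q) * (of_real q * z) = z" by simp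
  then show ?thesis
    unfolding dR_bar_def extend0_def dot_f(2)[OF norm_q_mult(1)[OF z]] using nz_circle[OF z] by (simp only: if_False)
qed

lemma dR_circ: "circle_continuous (dR q f)"
  unfolding circle_continuous_def
proof
  fix n
  have "continuous_on (sphere 0 (q powi n)) (\<lambda>z. (F (n - 1) (of_real (q powi (-2)) * z) - f z) / (of_real (q powi (-2) - 1) * z))"
    using nz_circle powi_eq_iff[of "-2" 0]
    by (intro continuous_intros circle_continuousD[OF f_circ] circle_continuousD[OF circle_continuous_holomorphic[OF F_comp_holomorphic]])
       (auto simp del: of_real_diff)
  then show "continuous_on (sphere 0 (q powi n)) (dR q f)"
    by (rule continuous_on_eq) (simp add: dR_f)
qed

lemma dR_bar_circ: "circle_continuous (dR_bar q f)"
  unfolding circle_continuous_def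
proof
  fix n
  have "1 - q ^ 2 \<noteq> 0" using q_pos q_less_1 by (simp add: power2_eq_1_iff)
  then have "continuous_on (sphere 0 (q powi n)) (\<lambda>z. (f z - F (n + 1) z) / (of_real (1 - q ^ 2) * cnj z))"
    using nz_circle
    by (intro continuous_intros circle_continuousD[OF f_circ] circle_continuousD[OF circle_continuous_holomorphic[OF F_holomorphic]])
       (auto simp del: of_real_diff)
  then show "continuous_on (sphere 0 (q powi n)) (dR_bar q f)"
    by (rule continuous_on_eq) (simp add: dR_bar_f)
qed

text \<open>In the continued half of the quotient, two inward steps of the radius, one by contour
  shift and one hidden in z = q^2 w read from circle n - 1, bring F (n - 1) to its own circle, where
  it is f. The kernel then splits by \<open>Fq_ext_scale\<close>.\<close>

lemma Fourier_term_dR: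
  assumes \<zeta>: "norm \<zeta> = q powi m"
  shows "of_real (q powi (-2) - 1) * Fourier_term m \<zeta> (dR q f) n
    = Fourier_term m \<zeta> (\<lambda>z. f z / z) (n - 1) + \<zeta> * Fourier_term m \<zeta> f (n - 1) - Fourier_term m \<zeta> (\<lambda>z. f z / z) n"
proof -
  define C where "C = complex_of_real (q powi (-2))"
  have C: "C * of_real (q ^ 2) = 1" "C \<noteq> 0"
    unfolding C_def by (rule powi_minus_2_mult) simp
  have C1: "of_real (q powi (-2) - 1) \<noteq> (0::complex)" using powi_eq_iff[of "-2" 0] by (simp del: of_real_diff)
  let ?K = "\<lambda>z. Fq_ext q (m + n) (\<zeta> * z)"
  have hol: "(\<lambda>z. F (n - 1) (C * z) / z) holomorphic_on - {0}"
    by (intro holomorphic_intros F_comp_holomorphic C) auto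
  have "of_real (q powi (-2) - 1) * circle_mean (q powi n) (\<lambda>z. ?K z * dR q f z)
      = circle_mean (q powi n) (\<lambda>z. ?K z * (F (n - 1) (C * z) / z) + (-1) * (?K z * (f z / z)))"
    unfolding circle_mean_cmult[symmetric]
  proof (intro circle_mean_cong powi_nonneg)
    fix z :: complex assume z: "norm z = q powi n"
    show "of_real (q powi (-2) - 1) * (?K z * dR q f z) = ?K z * (F (n - 1) (C * z) / z) + (-1) * (?K z * (f z / z))"
      unfolding dR_f[OF z] C_def[symmetric] using C1 nz_circle[OF z] by (simp add: field_simps del: of_real_diff)
  qed
  also have "\<dots> = circle_mean (q powi n) (\<lambda>z. ?K z * (F (n - 1) (C * z) / z)) + (-1) * circle_mean (q powi n) (\<lambda>z. ?K z * (f z / z))"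
    by (rule circle_mean_kernel_add[OF circle_continuous_holomorphic[OF hol] circle_continuous_divide(1)[OF f_circ] \<zeta>]) simp
  \<comment> \<open>The shift goes to n + 1 because q^(n+1) = q^2 q^(n-1): after z = q^2 w the point
    w runs over the circle of index n - 1.\<close>
  also have "circle_mean (q powi n) (\<lambda>z. ?K z * (F (n - 1) (C * z) / z))
      = circle_mean (q powi (n + 1)) (\<lambda>z. ?K z * (F (n - 1) (C * z) / z))"
    by (rule mean_shift[OF hol \<zeta>]) auto
  also have "q powi (n + 1) = q ^ 2 * q powi (n - 1)"
    by (simp add: power_int_add power_int_diff power2_eq_square)
  also have "circle_mean (q ^ 2 * q powi (n - 1)) (\<lambda>z. ?K z * (F (n - 1) (C * z) / z))
      = circle_mean (q powi (n - 1)) (\<lambda>w. ?K (of_real (q ^ 2) * w) * (F (n - 1) (C * (of_real (q ^ 2) * w)) / (of_real (q ^ 2) * w)))"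
    by (rule circle_mean_scale[symmetric])
  also have "\<dots> = circle_mean (q powi (n - 1)) (\<lambda>w. C * (Fq_ext q (m + (n - 1)) (\<zeta> * w) * (f w / w) + \<zeta> * (Fq_ext q (m + (n - 1)) (\<zeta> * w) * f w)))"
  proof (intro circle_mean_cong powi_nonneg)
    fix w :: complex assume w: "norm w = q powi (n - 1)"
    have w0: "w \<noteq> 0" by (rule nz_circle[OF w])
    have 1: "?K (of_real (q ^ 2) * w) = (1 + \<zeta> * w) * Fq_ext q (m + (n - 1)) (\<zeta> * w)"
      using Fq_ext_scale[of "\<zeta> * w" "m + n"] norm_mult_powi[OF \<zeta> w]
      by (simp only: mult.left_commute[of \<zeta>] add_diff_eq)
    have 2: "C * (of_real (q ^ 2) * w) = w" using C by (simp only: mult.assoc[symmetric] mult_1)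
    have 3: "f w / (of_real (q ^ 2) * w) = C * (f w / w)" using C w0 by (simp add: field_simps del: of_real_power)
    show "?K (of_real (q ^ 2) * w) * (F (n - 1) (C * (of_real (q ^ 2) * w)) / (of_real (q ^ 2) * w))
        = C * (Fq_ext q (m + (n - 1)) (\<zeta> * w) * (f w / w) + \<zeta> * (Fq_ext q (m + (n - 1)) (\<zeta> * w) * f w))"
      unfolding 1 2 F_eq[OF w] 3 using w0 by (simp add: field_simps)
  qed
  also have "\<dots> = C * (circle_mean (q powi (n - 1)) (\<lambda>w. Fq_ext q (m + (n - 1)) (\<zeta> * w) * (f w / w))
      + \<zeta> * circle_mean (q powi (n - 1)) (\<lambda>w. Fq_ext q (m + (n - 1)) (\<zeta> * w) * f w))"
    unfolding circle_mean_cmult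
    by (subst circle_mean_kernel_add[OF circle_continuous_divide(1)[OF f_circ] f_circ \<zeta>]) auto
  finally have eq: "of_real (q powi (-2) - 1) * circle_mean (q powi n) (\<lambda>z. ?K z * dR q f z)
    = C * (circle_mean (q powi (n - 1)) (\<lambda>w. Fq_ext q (m + (n - 1)) (\<zeta> * w) * (f w / w))
      + \<zeta> * circle_mean (q powi (n - 1)) (\<lambda>w. Fq_ext q (m + (n - 1)) (\<zeta> * w) * f w)) + (-1) * circle_mean (q powi n) (\<lambda>z. ?K z * (f z / z))" .
  \<comment> \<open>The factor q^(-2) produced by 1 / (q^2 w) turns the weight of circle n into that
    of circle n - 1.\<close>
  have e: "complex_of_real (q powi (2 * (n - 1))) = of_real (q powi (2 * n)) * C"
  proof -
    have "2 * (n - 1) = 2 * n + (-2)" by simp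
    then show ?thesis unfolding C_def by (simp only: powi_add of_real_mult)
  qed
  show ?thesis
    unfolding Fourier_term_def e mult.left_commute[of "of_real (q powi (-2) - 1)"] eq
    by (simp only: ring_distribs mult_ac) simp
qed

text \<open>One inward contour shift puts F (n + 1) on its own circle. The kernel, now one circle
  inside that of its index, splits by \<open>Fq_ext_rec\<close>.\<close>

lemma Fourier_term_dR_bar:
  assumes \<zeta>: "norm \<zeta> = q powi m"
  shows "of_real (1 - q ^ 2) * Fourier_term m \<zeta> (dR_bar q f) n
    = Fourier_term m \<zeta> (\<lambda>z. f z / cnj z) n - Fourier_term m \<zeta> (\<lambda>z. f z / cnj z) (n + 1)
      - of_real (q powi (-2)) * cnj \<zeta> * Fourier_term m \<zeta> f (n + 1)"
proof -
  define C where "C = complex_of_real (q powi (-2))"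
  define E where "E = (\<lambda>n. complex_of_real (q powi (2 * n)))"
  have E0: "E n \<noteq> 0" for n by (simp add: E_def)
  have C1: "of_real (1 - q ^ 2) \<noteq> (0::complex)" using q_pos q_less_1 by (simp add: power2_eq_1_iff del: of_real_diff)
  \<comment> \<open>On a circle 1 / cnj z equals z divided by a constant. This makes the continued
    half holomorphic for the shift, and on circle n + 1 it is undone with the constant of that
    circle, which supplies the new weight.\<close>
  have cz: "z = E n / cnj z" if "norm z = q powi n" for z n
    using conj_on_circle[OF that] nz_circle[OF that] by (simp add: E_def field_simps)
  let ?K = "\<lambda>z. Fq_ext q (m + n) (\<zeta> * z)"
  have hol: "(\<lambda>z. F (n + 1) z * z) holomorphic_on - {0}"
    by (intro holomorphic_intros F_holomorphic)
  have "of_real (1 - q ^ 2) * circle_mean (q powi n) (\<lambda>z. ?K z * dR_bar q f z)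
      = circle_mean (q powi n) (\<lambda>z. ?K z * (f z / cnj z) + (- 1 / E n) * (?K z * (F (n + 1) z * z)))"
    unfolding circle_mean_cmult[symmetric]
  proof (intro circle_mean_cong powi_nonneg)
    fix z :: complex assume z: "norm z = q powi n"
    have "of_real (1 - q ^ 2) * dR_bar q f z = (f z - F (n + 1) z) / cnj z"
      unfolding dR_bar_f[OF z] using C1 by (simp del: of_real_diff)
    also have "\<dots> = f z / cnj z + (- 1 / E n) * (F (n + 1) z * z)"
      using cz[OF z] E0[of n] nz_circle[OF z] by (simp add: field_simps)
    finally have "?K z * (of_real (1 - q ^ 2) * dR_bar q f z) = ?K z * (f z / cnj z + (- 1 / E n) * (F (n + 1) z * z))"
      by (simp only:)
    then show "of_real (1 - q ^ 2) * (?K z * dR_bar q f z) = ?K z * (f z / cnj z) + (- 1 / E n) * (?K z * (F (n + 1) z * z))"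
      by (simp only: ring_distribs mult_ac)
  qed
  also have "\<dots> = circle_mean (q powi n) (\<lambda>z. ?K z * (f z / cnj z)) + (- 1 / E n) * circle_mean (q powi n) (\<lambda>z. ?K z * (F (n + 1) z * z))"
    by (rule circle_mean_kernel_add[OF circle_continuous_divide(2)[OF f_circ] circle_continuous_holomorphic[OF hol] \<zeta>]) simp
  also have "circle_mean (q powi n) (\<lambda>z. ?K z * (F (n + 1) z * z)) = circle_mean (q powi (n + 1)) (\<lambda>z. ?K z * (F (n + 1) z * z))"
    by (rule mean_shift[OF hol \<zeta>]) auto
  also have "\<dots> = circle_mean (q powi (n + 1)) (\<lambda>z. E (n + 1) * (Fq_ext q (m + (n + 1)) (\<zeta> * z) * (f z / cnj z)
      + (C * cnj \<zeta>) * (Fq_ext q (m + (n + 1)) (\<zeta> * z) * f z)))"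
  proof (intro circle_mean_cong powi_nonneg)
    fix z :: complex assume z: "norm z = q powi (n + 1)"
    have 1: "?K z = (1 + C * cnj (\<zeta> * z)) * Fq_ext q (m + (n + 1)) (\<zeta> * z)"
      using Fq_ext_rec[OF norm_mult_powi[OF \<zeta> z]] by (simp add: C_def del: complex_cnj_mult)
    have "f z * z = f z * (E (n + 1) / cnj z)" using cz[OF z] by simp
    then have 2: "F (n + 1) z * z = E (n + 1) * (f z / cnj z)" unfolding F_eq[OF z] by simp
    show "?K z * (F (n + 1) z * z) = E (n + 1) * (Fq_ext q (m + (n + 1)) (\<zeta> * z) * (f z / cnj z)
      + (C * cnj \<zeta>) * (Fq_ext q (m + (n + 1)) (\<zeta> * z) * f z))"
      unfolding 1 2 using nz_circle[OF z] by (simp add: field_simps)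
  qed
  also have "\<dots> = E (n + 1) * (circle_mean (q powi (n + 1)) (\<lambda>z. Fq_ext q (m + (n + 1)) (\<zeta> * z) * (f z / cnj z))
      + (C * cnj \<zeta>) * circle_mean (q powi (n + 1)) (\<lambda>z. Fq_ext q (m + (n + 1)) (\<zeta> * z) * f z))"
    unfolding circle_mean_cmult
    by (subst circle_mean_kernel_add[OF circle_continuous_divide(2)[OF f_circ] f_circ \<zeta>]) auto
  finally have "E n * (of_real (1 - q ^ 2) * circle_mean (q powi n) (\<lambda>z. ?K z * dR_bar q f z))
    = E n * circle_mean (q powi n) (\<lambda>z. ?K z * (f z / cnj z))
      - E (n + 1) * (circle_mean (q powi (n + 1)) (\<lambda>z. Fq_ext q (m + (n + 1)) (\<zeta> * z) * (f z / cnj z))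
      + (C * cnj \<zeta>) * circle_mean (q powi (n + 1)) (\<lambda>z. Fq_ext q (m + (n + 1)) (\<zeta> * z) * f z))"
    using E0[of n] by (simp add: ring_distribs)
  note eq = this
  have Ek: "complex_of_real (q powi (2 * k)) = E k" for k by (simp only: E_def)
  show ?thesis
    unfolding Fourier_term_def Ek C_def[symmetric] using eq by (simp only: ring_distribs mult_ac diff_diff_eq)
qed

text \<open>Near \<open>0\<close> the boundary term is small because \<open>f\<close> is bounded there, near \<open>\<infinity>\<close> because
  \<open>f\<close> is integrable.\<close>

lemma Fourier_term_decay:
  assumes g: "circle_continuous g" and gf: "\<And>z. norm (g z) = norm (f z) / norm z" and \<zeta>: "norm \<zeta> = q powi m"
  shows "(\<lambda>k. Fourier_term m \<zeta> g (int k)) \<longlonglongrightarrow> 0" "(\<lambda>k. Fourier_term m \<zeta> g (- int k)) \<longlonglongrightarrow> 0"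
proof -
  have q0: "(\<lambda>k. q ^ k) \<longlonglongrightarrow> 0" using q_pos q_less_1 by (intro LIMSEQ_realpow_zero) auto
  have mean: "circle_mean (q powi n) (\<lambda>z. norm (g z)) = q powi (- n) * circle_mean (q powi n) (\<lambda>z. norm (f z))" for n
  proof -
    have "circle_mean (q powi n) (\<lambda>z. norm (g z)) = circle_mean (q powi n) (\<lambda>z. q powi (- n) * norm (f z))"
      by (intro circle_mean_cong powi_nonneg) (simp add: gf power_int_minus divide_inverse mult.commute)
    then show ?thesis by (simp only: circle_mean_cmult)
  qed
  show "(\<lambda>k. Fourier_term m \<zeta> g (int k)) \<longlonglongrightarrow> 0"
  proof (rule Lim_null_comparison)
    have "(f \<longlongrightarrow> f 0) (at 0 within Gam_bar q)"
      using f_cont by (simp add: continuous_on_def Gam_bar_def)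
    then have "eventually (\<lambda>z. dist (f z) (f 0) < 1) (at 0 within Gam_bar q)" by (rule tendstoD) simp
    then obtain d where d: "d > 0" "\<And>z. z \<in> Gam_bar q \<Longrightarrow> z \<noteq> 0 \<Longrightarrow> norm z < d \<Longrightarrow> dist (f z) (f 0) < 1"
      by (auto simp: eventually_at)
    show "\<forall>\<^sub>F k in sequentially. norm (Fourier_term m \<zeta> g (int k)) \<le> q ^ k * (norm (f 0) + 1)"
      using order_tendstoD(2)[OF q0 d(1)]
    proof eventually_elim
      case (elim k)
      have "circle_mean (q powi int k) (\<lambda>z. norm (f z)) \<le> circle_mean (q powi int k) (\<lambda>z. norm (f 0) + 1)"
      proof (intro circle_mean_mono powi_nonneg continuous_intros circle_continuousD[OF f_circ])
        fix z :: complex assume z: "norm z = q powi int k"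
        then have "dist (f z) (f 0) < 1"
          using elim nz_circle[OF z] sphere_subset_Gam_bar[of "int k"] by (intro d(2)) auto
        then show "norm (f z) \<le> norm (f 0) + 1" using norm_triangle_ineq2[of "f z" "f 0"] by (simp add: dist_norm)
      qed
      then have "norm_term g (int k) \<le> q powi (2 * int k) * (q powi (- int k) * (norm (f 0) + 1))"
        unfolding norm_term_def mean circle_mean_const by (intro mult_left_mono) auto
      also have "\<dots> = q powi (2 * int k + - int k) * (norm (f 0) + 1)" by (simp only: powi_add mult.assoc)
      also have "2 * int k + - int k = int k" by simp
      finally show ?case using norm_Fourier_term_le[OF g \<zeta>, of "int k"] by simp
    qed
    show "(\<lambda>k. q ^ k * (norm (f 0) + 1)) \<longlonglongrightarrow> 0" by (intro tendsto_mult_left_zero q0)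
  qed
  show "(\<lambda>k. Fourier_term m \<zeta> g (- int k)) \<longlonglongrightarrow> 0"
  proof (rule Lim_null_comparison)
    show "(\<lambda>k. q ^ k * infsum (norm_term f) UNIV) \<longlonglongrightarrow> 0" by (intro tendsto_mult_left_zero q0)
    show "\<forall>\<^sub>F k in sequentially. norm (Fourier_term m \<zeta> g (- int k)) \<le> q ^ k * infsum (norm_term f) UNIV"
    proof (intro always_eventually allI)
      fix k
      have "norm_term g (- int k) = q ^ k * norm_term f (- int k)"
        unfolding norm_term_def mean by (simp add: mult_ac)
      also have "norm_term f (- int k) \<le> infsum (norm_term f) UNIV"
        using finite_sum_le_infsum[OF norm_term_summable[OF f_integrable f_circ], of "{- int k}"] norm_term_nonneg[OF f_circ] by simp
      finally show "norm (Fourier_term m \<zeta> g (- int k)) \<le> q ^ k * infsum (norm_term f) UNIV"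
        using norm_Fourier_term_le[OF g \<zeta>, of "- int k"] q_pos by (simp add: mult_left_mono)
    qed
  qed
qed

lemma Fourier_dR:
  assumes int: "integrable (mu q) (dR q f)" and \<zeta>: "norm \<zeta> = q powi m"
  shows "\<zeta> * Fourier q f \<zeta> = of_real (q powi (-2) - 1) * Fourier q (dR q f) \<zeta>"
proof -
  let ?c = "Fourier_term m \<zeta> (\<lambda>z. f z / z)"
  \<comment> \<open>The series of f is shifted by one so that, by \<open>Fourier_term_dR\<close>,
    only the differences of ?c remain.\<close>
  have "((\<lambda>n. of_real (q powi (-2) - 1) * Fourier_term m \<zeta> (dR q f) n + (- \<zeta>) * Fourier_term m \<zeta> f (n - 1))
      has_sum (of_real (q powi (-2) - 1) * Fourier q (dR q f) \<zeta> + (- \<zeta>) * Fourier q f \<zeta>)) UNIV"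
    using has_sum_shift_int[OF Fourier_has_sum[OF f_integrable f_circ \<zeta>], of "-1"]
    by (intro has_sum_add has_sum_cmult_right Fourier_has_sum int dR_circ \<zeta>) simp
  moreover have "of_real (q powi (-2) - 1) * Fourier_term m \<zeta> (dR q f) n + (- \<zeta>) * Fourier_term m \<zeta> f (n - 1) = ?c (n - 1) - ?c n" for n
    unfolding Fourier_term_dR[OF \<zeta>] by simp
  ultimately have "of_real (q powi (-2) - 1) * Fourier q (dR q f) \<zeta> + (- \<zeta>) * Fourier q f \<zeta> = 0"
    by (rule has_sum_telescope_int) (rule Fourier_term_decay[OF circle_continuous_divide(1)[OF f_circ] _ \<zeta>], simp add: norm_divide)+
  then show ?thesis by simp
qed

lemma Fourier_dR_bar:
  assumes int: "integrable (mu q) (dR_bar q f)" and \<zeta>: "norm \<zeta> = q powi m"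
  shows "cnj \<zeta> * Fourier q f \<zeta> = - of_real (q ^ 2 - q ^ 4) * Fourier q (dR_bar q f) \<zeta>"
proof -
  let ?c = "Fourier_term m \<zeta> (\<lambda>z. f z / cnj z)"
  let ?C = "complex_of_real (q powi (-2))"
  have "((\<lambda>n. of_real (1 - q ^ 2) * Fourier_term m \<zeta> (dR_bar q f) (n - 1) + ?C * cnj \<zeta> * Fourier_term m \<zeta> f n)
      has_sum (of_real (1 - q ^ 2) * Fourier q (dR_bar q f) \<zeta> + ?C * cnj \<zeta> * Fourier q f \<zeta>)) UNIV"
    using has_sum_shift_int[OF Fourier_has_sum[OF int dR_bar_circ \<zeta>], of "-1"]
    by (intro has_sum_add has_sum_cmult_right Fourier_has_sum f_integrable f_circ \<zeta>) simp
  moreover have "of_real (1 - q ^ 2) * Fourier_term m \<zeta> (dR_bar q f) (n - 1) + ?C * cnj \<zeta> * Fourier_term m \<zeta> f n = ?c (n - 1) - ?c n" for n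
    unfolding Fourier_term_dR_bar[OF \<zeta>] by simp
  ultimately have *: "of_real (1 - q ^ 2) * Fourier q (dR_bar q f) \<zeta> + ?C * cnj \<zeta> * Fourier q f \<zeta> = 0"
    by (rule has_sum_telescope_int) (rule Fourier_term_decay[OF circle_continuous_divide(2)[OF f_circ] _ \<zeta>], simp add: norm_divide)+
  have C: "of_real (q ^ 2) * ?C = 1" using powi_minus_2_mult by (simp only: mult.commute)
  \<comment> \<open>Clearing the q^(-2) of \<open>Fq_ext_rec\<close> gives the constant q^2 (1 -
    q^2) = q^2 - q^4.\<close>
  have "of_real (q ^ 2) * (of_real (1 - q ^ 2) * Fourier q (dR_bar q f) \<zeta> + ?C * cnj \<zeta> * Fourier q f \<zeta>)
      = of_real (q ^ 2) * of_real (1 - q ^ 2) * Fourier q (dR_bar q f) \<zeta> + (of_real (q ^ 2) * ?C) * (cnj \<zeta> * Fourier q f \<zeta>)"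
    by (simp only: ring_distribs mult_ac)
  then have "of_real (q ^ 2) * of_real (1 - q ^ 2) * Fourier q (dR_bar q f) \<zeta> + cnj \<zeta> * Fourier q f \<zeta> = 0"
    unfolding * C by simp
  moreover have "of_real (q ^ 2) * of_real (1 - q ^ 2) = complex_of_real (q ^ 2 - q ^ 4)"
    by (simp add: algebra_simps flip: power_add)
  ultimately show ?thesis by (simp only: add_eq_0_iff mult_minus_left)
qed

section \<open>Outward continuation of the transform\<close>

text \<open>Rotating \<open>\<zeta>\<close> by \<open>q\<^bsup>it\<^esup>\<close> amounts to rotating the argument of \<open>f\<close> by \<open>q\<^bsup>-it\<^esup>\<close>, so these are
  the terms of the series for \<open>(\<F> f)(q\<^sup>-\<^sup>1 \<cdot> \<xi>)\<close>. The kernel itself need not continue that far.\<close>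

definition outward_term :: "int \<Rightarrow> complex \<Rightarrow> int \<Rightarrow> complex" where
  "outward_term m \<xi> n = of_real (q powi (2 * n)) * circle_mean (q powi n) (\<lambda>z. Fq_ext q (m + n) (\<xi> * z) * F n (of_real q * z))"

text \<open>Rotation invariance of the mean moves x from the kernel to f as 1/x. The continuations F
  n are holomorphic on the whole punctured plane, so the pole of the kernel is no obstacle.\<close>

lemma Fourier_continues_outward:
  assumes B: "\<And>n \<xi>. norm \<xi> = q powi m \<Longrightarrow> norm (outward_term m \<xi> n) \<le> B n" "B summable_on UNIV"
    and \<zeta>: "norm \<zeta> = q powi m" and v: "(outward_term m \<zeta> has_sum v) UNIV"
  shows "continues_to q (-1) (Fourier q f) \<zeta> v"
proof -
  define H where "H = (\<lambda>n x. of_real (q powi (2 * n)) * circle_mean (q powi n) (\<lambda>z. F n (inverse x * z) * Fq_ext q (m + n) (\<zeta> * z)))"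
  have rot: "circle_mean (q powi n) (\<lambda>z. F n (y * z) * Fq_ext q (m + n) (\<zeta> * z))
      = circle_mean (q powi n) (\<lambda>z. Fq_ext q (m + n) (e * \<zeta> * z) * F n (y * (e * z)))" if e: "norm e = 1" and y: "y \<noteq> 0" for n y e
  proof -
    have "continuous_on (sphere 0 (q powi n)) (\<lambda>z. F n (y * z) * Fq_ext q (m + n) (\<zeta> * z))"
      by (intro continuous_intros Fq_ext_mult_continuous[OF \<zeta>] circle_continuousD[OF circle_continuous_holomorphic[OF F_comp_holomorphic[OF y]]]) simp
    from circle_mean_rotate[OF powi_nonneg this e] show ?thesis by (simp add: mult_ac)
  qed
  have H1: "H n x = Fourier_term m (x * \<zeta>) f n" if x: "norm x = 1" for n x
  proof -
    have x0: "x \<noteq> 0" using x by auto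
    have "circle_mean (q powi n) (\<lambda>z. Fq_ext q (m + n) (x * \<zeta> * z) * F n (inverse x * (x * z))) =
          circle_mean (q powi n) (\<lambda>z. Fq_ext q (m + n) (x * \<zeta> * z) * f z)"
    proof (intro circle_mean_cong powi_nonneg)
      fix z :: complex assume "norm z = q powi n"
      moreover have "inverse x * (x * z) = z" using x0 by simp
      ultimately show "Fq_ext q (m + n) (x * \<zeta> * z) * F n (inverse x * (x * z)) = Fq_ext q (m + n) (x * \<zeta> * z) * f z"
        by (simp only: F_eq)
    qed
    then show ?thesis unfolding H_def Fourier_term_def using rot[OF x, of "inverse x"] x0 by simp
  qed
  \<comment> \<open>At x = e / q the argument of F n is q z / e; rotating z by e leaves q z and
    moves e to \<zeta>.\<close>
  have H2: "H n (e * of_real (inverse q)) = outward_term m (e * \<zeta>) n" if e: "norm e = 1" for n e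
  proof -
    have e0: "e \<noteq> 0" using e by auto
    define y where "y = inverse (e * of_real (inverse q))"
    have y0: "y \<noteq> 0" using e0 by (simp add: y_def)
    have y: "y * (e * z) = of_real q * z" for z using e0 by (simp add: y_def field_simps)
    show ?thesis unfolding H_def outward_term_def y_def[symmetric] rot[OF e y0] y ..
  qed
  have pq: "q powr (-1) = inverse q" using q_pos by (simp add: powr_minus)
  have iq: "inverse q > 1" using q_pos q_less_1 by (simp add: one_less_inverse_iff)
  \<comment> \<open>\<open>norm_term f\<close> bounds the terms on the unit circle, B those on the
    circle of radius 1/q.\<close>
  define B' where "B' = (\<lambda>n. B n + norm_term f n)"
  have B0: "B n \<ge> 0" for n using order_trans[OF norm_ge_zero B(1)[OF \<zeta>]] .
  show ?thesis
  proof (rule continues_to_series[where H = H and B = B' and U = "\<lambda>_. - {0}"])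
    show "H n holomorphic_on - {0}" for n
    proof -
      have "(\<lambda>y. circle_mean (q powi n) (\<lambda>z. F n (y * z) * Fq_ext q (m + n) (\<zeta> * z))) holomorphic_on - {0}"
        by (rule circle_mean_holomorphic[OF F_holomorphic _ Fq_ext_mult_continuous[OF \<zeta>] powi_pos]) (use nz_circle in auto)
      then have "(\<lambda>x. circle_mean (q powi n) (\<lambda>z. F n (inverse x * z) * Fq_ext q (m + n) (\<zeta> * z))) holomorphic_on - {0}"
        by (rule holomorphic_on_compose_gen[of inverse "- {0}", unfolded o_def, rotated]) (auto intro!: holomorphic_intros)
      then show ?thesis unfolding H_def by (intro holomorphic_intros)
    qed
    show "x \<in> - {0}" if "min 1 (q powr (-1)) \<le> norm x" "norm x \<le> max 1 (q powr (-1))" for x :: complex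
      using that iq unfolding pq by auto
    show "norm (H n x) \<le> B' n" if "norm x = 1 \<or> norm x = q powr (-1)" for n x
      using that
    proof
      assume x: "norm x = 1"
      have "norm (x * \<zeta>) = q powi m" using x \<zeta> by (simp add: norm_mult)
      then have "norm (H n x) \<le> norm_term f n" unfolding H1[OF x] by (rule norm_Fourier_term_le[OF f_circ])
      then show ?thesis using B0[of n] by (simp add: B'_def)
    next
      assume x: "norm x = q powr (-1)"
      define e where "e = x * of_real q"
      have e: "norm e = 1" using x q_pos unfolding e_def pq by (simp add: norm_mult)
      have xe: "x = e * of_real (inverse q)" by (simp add: e_def)
      have "norm (e * \<zeta>) = q powi m" using e \<zeta> by (simp add: norm_mult)
      then have "norm (H n x) \<le> B n" unfolding xe H2[OF e] by (rule B(1))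
      then show ?thesis using norm_term_nonneg[OF f_circ, of n] by (simp add: B'_def)
    qed
    show "B' summable_on UNIV"
      unfolding B'_def by (intro summable_on_add B norm_term_summable f_integrable f_circ)
    show "((\<lambda>n. H n x) has_sum Fourier q f (x * \<zeta>)) UNIV" if x: "norm x = 1" for x
      unfolding H1[OF x] by (rule Fourier_has_sum[OF f_integrable f_circ]) (simp add: norm_mult x \<zeta>)
    show "((\<lambda>n. H n (of_real (q powr (-1)))) has_sum v) UNIV"
      using H2[of 1] v unfolding pq by simp
  qed (use q_pos q_less_1 in auto)
qed

end

section \<open>Values of the inward continuation and extension to 0\<close>

context unit_base
begin

lemma Fourier_continues_inward_star:
  assumes g: "integrable (mu q) g" "circle_continuous g" and Zg: "integrable (mu q) (Zop_star g)"
    and \<zeta>: "norm \<zeta> = q powi m"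
  shows "continues_to q 1 (Fourier q g) \<zeta> (Fourier q g (of_real q * \<zeta>)
    + of_real (q powi (-2)) * cnj (of_real q * \<zeta>) * Fourier q (Zop_star g) (of_real q * \<zeta>))"
proof (rule Fourier_continues_inward[OF g Zg \<zeta>])
  have q\<zeta>: "norm (of_real q * \<zeta>) = q powi (m + 1)" using \<zeta> by (simp add: norm_mult power_int_add)
  show "(Fourier_term m (of_real q * \<zeta>) g has_sum (Fourier q g (of_real q * \<zeta>)
    + of_real (q powi (-2)) * cnj (of_real q * \<zeta>) * Fourier q (Zop_star g) (of_real q * \<zeta>))) UNIV"
    unfolding Fourier_term_down[OF g(2) q\<zeta>, abs_def]
    by (intro has_sum_add has_sum_cmult_right Fourier_has_sum g Zg circle_continuous_Zop q\<zeta>)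
qed

text \<open>The form needed for \<open>dL\<close>: the first summand is the transform at \<zeta>
  itself, so it cancels in the difference quotient. \<open>Fourier_continues_inward_star\<close>
  does the same for \<open>dL_bar\<close> after \<zeta> is replaced by \<zeta> / q.\<close>

lemma Fourier_continues_inward_Zop:
  assumes g: "integrable (mu q) g" "circle_continuous g" and Zg: "integrable (mu q) (Zop g)"
    and \<zeta>: "norm \<zeta> = q powi m"
  shows "continues_to q 1 (Fourier q g) (of_real q * \<zeta>) (Fourier q g \<zeta> + \<zeta> * Fourier q (Zop g) \<zeta>)"
proof (rule Fourier_continues_inward[OF g])
  show q\<zeta>: "norm (of_real q * \<zeta>) = q powi (m + 1)" using \<zeta> by (simp add: norm_mult power_int_add)
  show "integrable (mu q) (Zop_star g)"
    using Zg integrable_Zop_iff[OF borel_measurable_integrable[OF g(1)]] by blast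
  have "of_real q * (of_real q * \<zeta>) = of_real (q ^ 2) * \<zeta>" by (simp add: power2_eq_square)
  then show "(Fourier_term (m + 1) (of_real q * (of_real q * \<zeta>)) g has_sum (Fourier q g \<zeta> + \<zeta> * Fourier q (Zop g) \<zeta>)) UNIV"
    unfolding Fourier_term_up[OF g(2) \<zeta>, abs_def]
    by (simp only: Fourier_term_up[OF g(2) \<zeta>, abs_def])
       (intro has_sum_add has_sum_cmult_right Fourier_has_sum g Zg circle_continuous_Zop \<zeta>)
qed

text \<open>A transform has a limit at 0, so a quotient that equals c times a transform on the
  circles takes the matching value at 0 under \<open>extend0\<close>.\<close>

lemma extend0_Fourier:
  assumes u: "integrable (mu q) u" and h: "\<And>\<zeta> m. norm \<zeta> = q powi m \<Longrightarrow> h \<zeta> = c * Fourier q u \<zeta>"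
  shows "\<forall>\<zeta>\<in>Gam_bar q. extend0 q h \<zeta> = c * Fourier q u \<zeta>"
    "\<exists>l. (extend0 q h \<longlongrightarrow> l) (at 0 within Gam q)"
proof -
  have lim: "((\<lambda>\<zeta>. c * Fourier q u \<zeta>) \<longlongrightarrow> c * Fourier q u 0) (at 0 within Gam q)"
    by (intro tendsto_intros Fourier_tendsto_0 u)
  have nz: "extend0 q h \<zeta> = c * Fourier q u \<zeta> \<and> h \<zeta> = c * Fourier q u \<zeta>" if "\<zeta> \<in> Gam q" for \<zeta>
    using that h nz_circle by (auto simp: Gam_def extend0_def)
  have ev: "eventually (\<lambda>\<zeta>. \<zeta> \<in> Gam q) (at 0 within Gam q)"
    by (simp add: eventually_at_filter)
  have "eventually (\<lambda>\<zeta>. c * Fourier q u \<zeta> = h \<zeta>) (at 0 within Gam q)"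
    using ev by eventually_elim (simp add: nz)
  then have "(h \<longlongrightarrow> c * Fourier q u 0) (at 0 within Gam q)" by (rule Lim_transform_eventually[OF lim])
  then have "Lim (at 0 within Gam q) h = c * Fourier q u 0" by (rule tendsto_Lim[OF nontrivial_at_0])
  then show "\<forall>\<zeta>\<in>Gam_bar q. extend0 q h \<zeta> = c * Fourier q u \<zeta>"
    using nz by (auto simp: Gam_bar_def extend0_def)
  have "eventually (\<lambda>\<zeta>. c * Fourier q u \<zeta> = extend0 q h \<zeta>) (at 0 within Gam q)"
    using ev by eventually_elim (simp add: nz)
  then show "\<exists>l. (extend0 q h \<longlongrightarrow> l) (at 0 within Gam q)"
    using Lim_transform_eventually[OF lim] by blast
qed

lemma eq_on_Gam_bar:
  fixes a b :: "complex \<Rightarrow> complex"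
  assumes "(a \<longlongrightarrow> a 0) (at 0 within Gam q)" "(b \<longlongrightarrow> b 0) (at 0 within Gam q)"
    and eq: "\<And>\<zeta> m. norm \<zeta> = q powi m \<Longrightarrow> a \<zeta> = b \<zeta>"
  shows "\<forall>\<zeta>\<in>Gam_bar q. a \<zeta> = b \<zeta>"
proof -
  have "eventually (\<lambda>\<zeta>. a \<zeta> = b \<zeta>) (at 0 within Gam q)"
    unfolding eventually_at_filter using eq by (intro always_eventually) (auto simp: Gam_def)
  then have "(b \<longlongrightarrow> a 0) (at 0 within Gam q)" by (rule Lim_transform_eventually[OF assms(1)])
  then have "a 0 = b 0" using tendsto_unique[OF nontrivial_at_0 _ assms(2)] by blast
  then show ?thesis using eq by (auto simp: Gam_bar_def Gam_def)
qed

lemma continuable_if: "(\<And>z n. norm z = q powi n \<Longrightarrow> continues_to q s g z (w z)) \<Longrightarrow> continuable q s g"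
  by (auto simp: continuable_def Gam_def)

end

context q_function
begin

section \<open>Derivatives of the Fourier transform\<close>

text \<open>The index of the continuation follows the scaling: theta reads f on circle n + 1, its
  inverse on circle n - 1. In the second case the arguments cancel and only the change of index
  remains.\<close>

lemma sigma_theta:
  assumes z: "norm z = q powi n"
  shows "(sigma_i q \<circ> theta q) f z = F (n + 1) (of_real q * (of_real q * z))"
    "(sigma_i q \<circ> theta_inv q) f z = F (n - 1) z"
proof -
  have "continues_to q 1 (theta q f) z (F (n + 1) (of_real q * (of_real (q powr 1) * z)))"
    by (rule continues_to_holomorphic[OF q_pos F_comp_holomorphic nz_circle[OF z]])
       (auto simp: theta_def z F_eq norm_q_mult)
  then show "(sigma_i q \<circ> theta q) f z = F (n + 1) (of_real q * (of_real q * z))"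
    using q_pos by (simp add: sigma_i_def dot_eq)
  have "continues_to q 1 (theta_inv q f) z (F (n - 1) (of_real (inverse q) * (of_real (q powr 1) * z)))"
    by (rule continues_to_holomorphic[OF q_pos F_comp_holomorphic nz_circle[OF z]])
       (simp_all only: theta_inv_def z F_eq norm_q_mult, simp)
  moreover have "of_real (inverse q) * (of_real (q powr 1) * z) = z" using q_pos by simp
  ultimately show "(sigma_i q \<circ> theta_inv q) f z = F (n - 1) z"
    unfolding sigma_i_def o_def by (intro dot_eq) (simp, simp only:)
qed

lemma circle_continuous_sigma_theta:
  "circle_continuous (Zop ((sigma_i q \<circ> theta q) f))" "circle_continuous (Zop_star ((sigma_i q \<circ> theta_inv q) f))"
proof -
  have "continuous_on (sphere 0 (q powi n)) ((sigma_i q \<circ> theta q) f)"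
       "continuous_on (sphere 0 (q powi n)) ((sigma_i q \<circ> theta_inv q) f)" for n
  proof -
    have "continuous_on (sphere 0 (q powi n)) (\<lambda>z. F (n + 1) ((of_real q * of_real q) * z))"
      by (rule circle_continuousD[OF circle_continuous_holomorphic[OF F_comp_holomorphic]]) simp
    then show "continuous_on (sphere 0 (q powi n)) ((sigma_i q \<circ> theta q) f)"
      by (rule continuous_on_eq) (simp only: mem_sphere_0 sigma_theta(1) mult.assoc)
    have "continuous_on (sphere 0 (q powi n)) (F (n - 1))"
      by (rule circle_continuousD[OF circle_continuous_holomorphic[OF F_holomorphic]])
    then show "continuous_on (sphere 0 (q powi n)) ((sigma_i q \<circ> theta_inv q) f)"
      by (rule continuous_on_eq) (simp only: mem_sphere_0 sigma_theta(2))
  qed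
  then show "circle_continuous (Zop ((sigma_i q \<circ> theta q) f))" "circle_continuous (Zop_star ((sigma_i q \<circ> theta_inv q) f))"
    by (intro circle_continuous_Zop; simp only: circle_continuous_def; blast)+
qed

text \<open>Shifting the contour inwards and substituting z = q w creates the argument q w of F n
  that \<open>outward_term\<close> has.\<close>

lemma Fourier_term_shift_rescale:
  assumes \<xi>: "norm \<xi> = q powi m"
  shows "circle_mean (q powi n) (\<lambda>z. Fq_ext q (m + n) (\<xi> * z) * f z)
    = circle_mean (q powi n) (\<lambda>w. Fq_ext q (m + n) (\<xi> * (of_real q * w)) * F n (of_real q * w))"
proof -
  have "circle_mean (q powi n) (\<lambda>z. Fq_ext q (m + n) (\<xi> * z) * f z) = circle_mean (q powi n) (\<lambda>z. Fq_ext q (m + n) (\<xi> * z) * F n z)"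
    by (intro circle_mean_cong) (simp_all add: F_eq)
  also have "\<dots> = circle_mean (q powi (n + 1)) (\<lambda>z. Fq_ext q (m + n) (\<xi> * z) * F n z)"
    by (rule mean_shift[OF F_holomorphic \<xi>]) auto
  finally show ?thesis unfolding mean_rescale[of n "\<lambda>z. Fq_ext q (m + n) (\<xi> * z) * F n z"] .
qed

lemma powi_double_add_2: "complex_of_real (q powi (2 * (n + 1))) = of_real (q powi (2 * n)) * of_real (q ^ 2)"
proof -
  have "q powi (2 * (n + 1)) = q powi (2 * n) * q ^ 2"
    by (simp add: power_int_add distrib_left)
  then show ?thesis by (simp only: of_real_mult)
qed

text \<open>After \<open>Fourier_term_shift_rescale\<close> the term of f at q \<xi> has the kernel
  argument q^2 \<xi> w, and \<open>Fq_ext_scale\<close> splits it into \<open>outward_term\<close>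
  and a part with \<xi> w. That part is the term of the transformed function on circle n - 1. In
  q^3, the ratio of weights contributes q^2 and the substitution w = q z contributes q.\<close>

lemma outward_term_theta:
  assumes \<xi>: "norm \<xi> = q powi m"
  shows "outward_term m \<xi> n = Fourier_term (m + 1) (of_real q * \<xi>) f n
    - of_real (q ^ 3) * \<xi> * Fourier_term (m + 1) (of_real q * \<xi>) (Zop ((sigma_i q \<circ> theta q) f)) (n - 1)"
proof -
  define Q where "Q = complex_of_real q"
  have Q0: "Q \<noteq> 0" by (simp add: Q_def)
  let ?K = "\<lambda>w. Fq_ext q (m + n) (\<xi> * w)"
  have hol: "(\<lambda>z. F n (Q * z)) holomorphic_on - {0}" by (rule F_comp_holomorphic[OF Q0])
  have hol': "(\<lambda>z. z * F n (Q * z)) holomorphic_on - {0}" by (intro holomorphic_intros hol)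
  define X where "X = circle_mean (q powi n) (\<lambda>w. ?K w * (w * F n (Q * w)))"
  define Y where "Y = circle_mean (q powi n) (\<lambda>w. ?K w * F n (Q * w))"
  define E where "E = (\<lambda>n. complex_of_real (q powi (2 * n)))"
  have q\<xi>: "norm (Q * \<xi>) = q powi (m + 1)" unfolding Q_def by (rule norm_q_mult(1)[OF \<xi>])
  have "circle_mean (q powi n) (\<lambda>z. Fq_ext q (m + 1 + n) (Q * \<xi> * z) * f z)
     = circle_mean (q powi n) (\<lambda>w. Fq_ext q (m + 1 + n) (Q * \<xi> * (Q * w)) * F n (Q * w))"
    using Fourier_term_shift_rescale[OF q\<xi>] unfolding Q_def .
  also have "\<dots> = circle_mean (q powi n) (\<lambda>w. ?K w * F n (Q * w) + \<xi> * (?K w * (w * F n (Q * w))))"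
  proof (intro circle_mean_cong powi_nonneg)
    fix w :: complex assume w: "norm w = q powi n"
    have "Q * \<xi> * (Q * w) = of_real (q ^ 2) * (\<xi> * w)" by (simp add: Q_def power2_eq_square)
    moreover have "Fq_ext q (m + 1 + n) (of_real (q ^ 2) * (\<xi> * w)) = (1 + \<xi> * w) * ?K w"
      using Fq_ext_scale[of "\<xi> * w" "m + 1 + n"] norm_mult_powi[OF \<xi> w] by simp
    ultimately have "Fq_ext q (m + 1 + n) (Q * \<xi> * (Q * w)) = (1 + \<xi> * w) * ?K w" by (simp only:)
    then show "Fq_ext q (m + 1 + n) (Q * \<xi> * (Q * w)) * F n (Q * w) = ?K w * F n (Q * w) + \<xi> * (?K w * (w * F n (Q * w)))"
      by (simp only: ring_distribs mult_1 mult_ac)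
  qed
  also have "\<dots> = Y + \<xi> * X"
    unfolding X_def Y_def
    by (rule circle_mean_kernel_add[OF circle_continuous_holomorphic[OF hol] circle_continuous_holomorphic[OF hol'] \<xi>]) simp
  finally have 1: "Fourier_term (m + 1) (Q * \<xi>) f n = E n * (Y + \<xi> * X)"
    unfolding Fourier_term_def E_def by (simp only:)
  have "circle_mean (q powi (n - 1)) (\<lambda>z. Fq_ext q (m + 1 + (n - 1)) (Q * \<xi> * z) * Zop ((sigma_i q \<circ> theta q) f) z)
     = circle_mean (q powi (n - 1)) (\<lambda>z. ?K (Q * z) * ((Q * z) * F n (Q * (Q * z)) / Q))"
  proof (intro circle_mean_cong powi_nonneg)
    fix z :: complex assume z: "norm z = q powi (n - 1)"
    have "Zop ((sigma_i q \<circ> theta q) f) z = (Q * z) * F n (Q * (Q * z)) / Q"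
      unfolding Zop_def sigma_theta(1)[OF z] using Q0 by (simp add: Q_def)
    moreover have "m + 1 + (n - 1) = m + n" "Q * \<xi> * z = \<xi> * (Q * z)" by simp_all
    ultimately show "Fq_ext q (m + 1 + (n - 1)) (Q * \<xi> * z) * Zop ((sigma_i q \<circ> theta q) f) z
        = ?K (Q * z) * ((Q * z) * F n (Q * (Q * z)) / Q)" by (simp only:)
  qed
  also have "\<dots> = circle_mean (q powi n) (\<lambda>w. ?K w * (w * F n (Q * w) / Q))"
    using mean_rescale[of "n - 1" "\<lambda>w. ?K w * (w * F n (Q * w) / Q)"] by (simp add: Q_def)
  also have "\<dots> = inverse Q * X"
    unfolding X_def circle_mean_cmult[symmetric] by (simp add: divide_inverse mult_ac)
  finally have 2: "Fourier_term (m + 1) (Q * \<xi>) (Zop ((sigma_i q \<circ> theta q) f)) (n - 1) = E (n - 1) * (inverse Q * X)"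
    unfolding Fourier_term_def E_def by (simp only:)
  have 3: "E n = E (n - 1) * Q ^ 2" using powi_double_add_2[of "n - 1"] by (simp add: E_def Q_def)
  have "outward_term m \<xi> n = E n * Y" unfolding outward_term_def E_def Y_def Q_def ..
  then show ?thesis
    unfolding Q_def[symmetric] of_real_power 1 2 3 using Q0 by (simp add: field_simps power2_eq_square power3_eq_cube)
qed

text \<open>The term of f at \<xi> / q now has kernel argument \<xi> w, one circle inside that of
  its index, and \<open>Fq_ext_rec\<close> splits it. Of q^(-5), the factor q^(-2) comes from that
  equation, q^(-2) from the weights of circles n and n + 1, and q^(-1) from cnj w = cnj z /
  q.\<close>

lemma outward_term_theta_inv:
  assumes \<xi>: "norm \<xi> = q powi m"
  shows "outward_term m \<xi> n = Fourier_term (m - 1) (of_real (inverse q) * \<xi>) f n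
    - of_real (q powi (-5)) * cnj \<xi> * Fourier_term (m - 1) (of_real (inverse q) * \<xi>) (Zop_star ((sigma_i q \<circ> theta_inv q) f)) (n + 1)"
proof -
  define Q where "Q = complex_of_real q"
  define P where "P = complex_of_real (inverse q)"
  have Q0: "Q \<noteq> 0" and PQ: "P * Q = 1" "P = inverse Q" by (simp_all add: Q_def P_def)
  have P\<xi>: "P * \<xi> * (Q * w) = \<xi> * w" for w using Q0 by (simp add: PQ)
  define C where "C = complex_of_real (q powi (-2))"
  let ?K = "\<lambda>w. Fq_ext q (m + n) (\<xi> * w)"
  have hol: "(\<lambda>z. F n (Q * z)) holomorphic_on - {0}" by (rule F_comp_holomorphic[OF Q0])
  have cc: "circle_continuous (\<lambda>z. cnj z * F n (Q * z))"
    using circle_continuous_Zop(2)[OF circle_continuous_holomorphic[OF hol]] by (simp add: Zop_star_def[abs_def])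
  define X where "X = circle_mean (q powi n) (\<lambda>w. ?K w * (cnj w * F n (Q * w)))"
  define Y where "Y = circle_mean (q powi n) (\<lambda>w. ?K w * F n (Q * w))"
  define E where "E = (\<lambda>n. complex_of_real (q powi (2 * n)))"
  have q\<xi>: "norm (P * \<xi>) = q powi (m - 1)" unfolding P_def by (rule norm_q_mult(2)[OF \<xi>])
  have "circle_mean (q powi n) (\<lambda>z. Fq_ext q (m - 1 + n) (P * \<xi> * z) * f z)
     = circle_mean (q powi n) (\<lambda>w. Fq_ext q (m - 1 + n) (P * \<xi> * (Q * w)) * F n (Q * w))"
    using Fourier_term_shift_rescale[OF q\<xi>] unfolding Q_def .
  also have "\<dots> = circle_mean (q powi n) (\<lambda>w. ?K w * F n (Q * w) + (C * cnj \<xi>) * (?K w * (cnj w * F n (Q * w))))"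
  proof (intro circle_mean_cong powi_nonneg)
    fix w :: complex assume w: "norm w = q powi n"
    have "m - 1 + n = m + n - 1" by simp
    then have "Fq_ext q (m - 1 + n) (P * \<xi> * (Q * w)) = (1 + C * cnj (\<xi> * w)) * ?K w"
      unfolding P\<xi> C_def using Fq_ext_rec[OF norm_mult_powi[OF \<xi> w]] by (simp only:)
    then show "Fq_ext q (m - 1 + n) (P * \<xi> * (Q * w)) * F n (Q * w) = ?K w * F n (Q * w) + (C * cnj \<xi>) * (?K w * (cnj w * F n (Q * w)))"
      by (simp only: complex_cnj_mult ring_distribs mult_1 mult_ac)
  qed
  also have "\<dots> = Y + (C * cnj \<xi>) * X"
    unfolding X_def Y_def
    by (rule circle_mean_kernel_add[OF circle_continuous_holomorphic[OF hol] cc \<xi>]) simp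
  finally have 1: "Fourier_term (m - 1) (P * \<xi>) f n = E n * (Y + (C * cnj \<xi>) * X)"
    unfolding Fourier_term_def E_def by (simp only:)
  have "circle_mean (q powi (n + 1)) (\<lambda>z. Fq_ext q (m - 1 + (n + 1)) (P * \<xi> * z) * Zop_star ((sigma_i q \<circ> theta_inv q) f) z)
     = circle_mean (q powi (n + 1)) (\<lambda>z. Fq_ext q (m + n) (P * \<xi> * z) * (cnj z * F n z))"
    by (intro circle_mean_cong powi_nonneg) (simp add: Zop_star_def sigma_theta(2)[simplified])
  also have "\<dots> = circle_mean (q powi n) (\<lambda>w. Fq_ext q (m + n) (P * \<xi> * (Q * w)) * (cnj (Q * w) * F n (Q * w)))"
    unfolding Q_def by (rule mean_rescale[symmetric])
  also have "\<dots> = Q * X"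
    unfolding X_def circle_mean_cmult[symmetric] P\<xi> by (simp add: Q_def mult_ac)
  finally have 2: "Fourier_term (m - 1) (P * \<xi>) (Zop_star ((sigma_i q \<circ> theta_inv q) f)) (n + 1) = E (n + 1) * (Q * X)"
    unfolding Fourier_term_def E_def by (simp only:)
  have 3: "E (n + 1) = E n * Q ^ 2" using powi_double_add_2[of n] by (simp add: E_def Q_def)
  have 4: "complex_of_real (q powi (-5)) = C * inverse (Q ^ 3)"
  proof -
    have "q powi (-5) = q powi (-2) * q powi (-3)" by (simp flip: powi_add)
    also have "q powi (-3) = inverse (q ^ 3)" by (simp add: power_int_minus)
    finally show ?thesis unfolding C_def Q_def by (simp only: of_real_mult of_real_inverse of_real_power)
  qed
  have "outward_term m \<xi> n = E n * Y" unfolding outward_term_def E_def Y_def Q_def ..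
  then show ?thesis
    unfolding P_def[symmetric] 1 2 3 4 using Q0 by (simp add: field_simps power2_eq_square power3_eq_cube)
qed

text \<open>Common part of the two outward cases. The modulus D of d is constant on the circle, so
  the term relation gives a summable bound uniform in \<xi> as well as the value of the
  continuation.\<close>

lemma Fourier_continues_outward_relation:
  assumes u: "integrable (mu q) u" "circle_continuous u"
    and c: "\<And>\<xi>. norm \<xi> = q powi m \<Longrightarrow> norm (c * \<xi>) = q powi m'"
    and d: "\<And>\<xi>. norm \<xi> = q powi m \<Longrightarrow> norm (d \<xi>) = D"
    and o: "\<And>\<xi> n. norm \<xi> = q powi m \<Longrightarrow> outward_term m \<xi> n = Fourier_term m' (c * \<xi>) f n - d \<xi> * Fourier_term m' (c * \<xi>) u (n + k)"
    and \<zeta>: "norm \<zeta> = q powi m"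
  shows "continues_to q (-1) (Fourier q f) \<zeta> (Fourier q f (c * \<zeta>) - d \<zeta> * Fourier q u (c * \<zeta>))"
proof (rule Fourier_continues_outward[OF _ _ \<zeta>])
  show "norm (outward_term m \<xi> n) \<le> norm_term f n + D * norm_term u (n + k)" if \<xi>: "norm \<xi> = q powi m" for n \<xi>
  proof -
    have "norm (outward_term m \<xi> n) \<le> norm (Fourier_term m' (c * \<xi>) f n) + norm (d \<xi> * Fourier_term m' (c * \<xi>) u (n + k))"
      unfolding o[OF \<xi>] by (rule norm_triangle_ineq4)
    also have "\<dots> \<le> norm_term f n + D * norm_term u (n + k)"
      unfolding norm_mult[of "d \<xi>"] d[OF \<xi>, symmetric]
      by (intro add_mono mult_left_mono norm_Fourier_term_le f_circ u c \<xi> norm_ge_zero)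
    finally show ?thesis .
  qed
  show "(\<lambda>n. norm_term f n + D * norm_term u (n + k)) summable_on UNIV"
    by (intro summable_on_add summable_on_cmult_right summable_on_shift_int norm_term_summable f_integrable f_circ u)
  have "((\<lambda>n. Fourier_term m' (c * \<zeta>) f n + (- d \<zeta>) * Fourier_term m' (c * \<zeta>) u (n + k))
    has_sum (Fourier q f (c * \<zeta>) + (- d \<zeta>) * Fourier q u (c * \<zeta>))) UNIV"
    by (intro has_sum_add has_sum_cmult_right has_sum_shift_int Fourier_has_sum f_integrable f_circ u c \<zeta>)
  then show "(outward_term m \<zeta> has_sum (Fourier q f (c * \<zeta>) - d \<zeta> * Fourier q u (c * \<zeta>))) UNIV"
    unfolding o[OF \<zeta>, abs_def] by simp
qed

lemma Fourier_continues_outward_theta: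
  fixes u
  defines "u \<equiv> Zop ((sigma_i q \<circ> theta q) f)"
  assumes "integrable (mu q) u" and \<zeta>: "norm \<zeta> = q powi m"
  shows "continues_to q (-1) (Fourier q f) \<zeta>
    (Fourier q f (of_real q * \<zeta>) - of_real (q ^ 3) * \<zeta> * Fourier q u (of_real q * \<zeta>))"
  using assms circle_continuous_sigma_theta
  by (intro Fourier_continues_outward_relation[where m = m and m' = "m + 1" and k = "-1" and D = "q ^ 3 * q powi m"])
     (simp_all add: norm_mult norm_power power_int_add outward_term_theta)

lemma Fourier_continues_outward_theta_inv:
  fixes u
  defines "u \<equiv> Zop_star ((sigma_i q \<circ> theta_inv q) f)"
  assumes "integrable (mu q) u" and \<zeta>: "norm \<zeta> = q powi m"
  shows "continues_to q (-1) (Fourier q f) \<zeta>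
    (Fourier q f (of_real (inverse q) * \<zeta>) - of_real (q powi (-5)) * cnj \<zeta> * Fourier q u (of_real (inverse q) * \<zeta>))"
proof (rule Fourier_continues_outward_relation[where m = m and m' = "m - 1" and k = 1 and D = "q powi (-5) * q powi m"])
  show "integrable (mu q) u" "circle_continuous u" using assms circle_continuous_sigma_theta by simp_all
  show "norm (of_real (q powi (-5)) * cnj \<xi>) = q powi (-5) * q powi m" if "norm \<xi> = q powi m" for \<xi>
    unfolding norm_mult complex_mod_cnj that norm_of_real abs_of_pos[OF powi_pos] ..
qed (simp_all only: norm_q_mult outward_term_theta_inv u_def \<zeta>)

end

theorem theorem6p1:
  fixes q :: real and f :: "complex \<Rightarrow> complex"
  assumes "0 < q" and "q < 1"
    and "f \<in> Cinf q" and "integrable (mu q) f"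
  shows
    "(integrable (mu q) (dR q f) \<longrightarrow>
        (\<forall>\<zeta>\<in>Gam_bar q. Zop (Fourier q f) \<zeta>
            = of_real (q powi (-2) - 1) * Fourier q (dR q f) \<zeta>)) \<and>
     (integrable (mu q) (dR_bar q f) \<longrightarrow>
        (\<forall>\<zeta>\<in>Gam_bar q. Zop_star (Fourier q f) \<zeta>
            = - of_real (q ^ 2 - q ^ 4) * Fourier q (dR_bar q f) \<zeta>)) \<and>
     (integrable (mu q) (Zop f) \<longrightarrow>
        diff_dom q 1 (dL q) (Fourier q f) \<and>
        (\<forall>\<zeta>\<in>Gam_bar q. dL q (Fourier q f) \<zeta>
            = - of_real (1 / (1 - q ^ 2)) * Fourier q (Zop f) \<zeta>)) \<and>
     (integrable (mu q) (Zop_star f) \<longrightarrow>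
        diff_dom q 1 (dL_bar q) (Fourier q f) \<and>
        (\<forall>\<zeta>\<in>Gam_bar q. dL_bar q (Fourier q f) \<zeta>
            = of_real (1 / (1 - q ^ 2)) * Fourier q (Zop_star f) \<zeta>)) \<and>
     (integrable (mu q) (Zop ((sigma_i q \<circ> theta q) f)) \<longrightarrow>
        diff_dom q (-1) (dR q) (Fourier q f) \<and>
        (\<forall>\<zeta>\<in>Gam_bar q. dR q (Fourier q f) \<zeta>
            = - of_real (q ^ 4 / (1 - q ^ 2))
                * Fourier q (Zop ((sigma_i q \<circ> theta q) f)) \<zeta>)) \<and>
     (integrable (mu q) (Zop_star ((sigma_i q \<circ> theta_inv q) f)) \<longrightarrow>
        diff_dom q (-1) (dR_bar q) (Fourier q f) \<and>
        (\<forall>\<zeta>\<in>Gam_bar q. dR_bar q (Fourier q f) \<zeta>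
            = of_real (q powi (-4) / (1 - q ^ 2))
                * Fourier q (Zop_star ((sigma_i q \<circ> theta_inv q) f)) \<zeta>))"
proof -
  interpret unit_base q by unfold_locales (fact assms)+
  have B: "continuous_on (Gam_bar q) f" "\<forall>n::int. \<exists>h. h holomorphic_on (- {0}) \<and> (\<forall>z. cmod z = q powi n \<longrightarrow> h z = f z)"
    using assms(3) by (auto simp: Cinf_def B_alg_def)
  obtain F where F: "F n holomorphic_on (- {0}) \<and> (\<forall>z. cmod z = q powi n \<longrightarrow> F n z = f z)" for n
    using choice[OF B(2)] by blast
  interpret q_function q f F by unfold_locales (use B F assms(4) in auto)
  let ?g = "Fourier q f"
  have fm: "f \<in> borel_measurable (mu q)" using assms(4) by (rule borel_measurable_integrable)
  have g0: "(?g \<longlongrightarrow> ?g 0) (at 0 within Gam q)" by (rule Fourier_tendsto_0[OF f_integrable])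
  have q2: "1 - q ^ 2 \<noteq> 0" "q ^ 2 \<noteq> 1" using q_pos q_less_1 by (simp_all add: power2_eq_1_iff)
  define s where "s = complex_of_real (1 - q ^ 2)"
  have s: "s \<noteq> 0" using q2 by (simp add: s_def del: of_real_diff)
  \<comment> \<open>Both quotients with q^(-2) - 1 thus have the factor q^(-2) in numerator and
    denominator, which leaves 1 - q^2.\<close>
  have sm: "complex_of_real (q powi (-2) - 1) = of_real (q powi (-2)) * s"
  proof -
    have "q powi (-2) - 1 = q powi (-2) * (1 - q ^ 2)" by (simp add: power_int_minus field_simps)
    then show ?thesis by (simp only: s_def of_real_mult)
  qed
  have iq: "of_real (inverse q) * (of_real q * \<zeta>) = \<zeta>" "of_real q * (of_real (inverse q) * \<zeta>) = \<zeta>" for \<zeta> :: complex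
    by simp_all
  define C where "C = complex_of_real (q powi (-2))"
  have C0: "C \<noteq> 0" by (simp add: C_def)
  show ?thesis
  proof (intro conjI impI)
    assume int: "integrable (mu q) (dR q f)"
    show "\<forall>\<zeta>\<in>Gam_bar q. Zop ?g \<zeta> = of_real (q powi (-2) - 1) * Fourier q (dR q f) \<zeta>"
      unfolding Zop_def[abs_def]
      by (rule eq_on_Gam_bar) (rule Fourier_dR[OF int] | assumption | intro tendsto_intros g0 Fourier_tendsto_0 int)+
  next
    assume int: "integrable (mu q) (dR_bar q f)"
    show "\<forall>\<zeta>\<in>Gam_bar q. Zop_star ?g \<zeta> = - of_real (q ^ 2 - q ^ 4) * Fourier q (dR_bar q f) \<zeta>"
      unfolding Zop_star_def[abs_def]
      by (rule eq_on_Gam_bar) (rule Fourier_dR_bar[OF int] | assumption | intro tendsto_intros g0 Fourier_tendsto_0 int)+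
  next
    assume int: "integrable (mu q) (Zop f)"
    \<comment> \<open>Continuability is required at every point of \<open>Gam q\<close>, where
      \<open>Fourier_continues_inward_star\<close> states it; its hypothesis is the same
      integrability condition, as |z| = |cnj z|.\<close>
    have ints: "integrable (mu q) (Zop_star f)" using int integrable_Zop_iff[OF fm] by blast
    have "(?g \<zeta> - dot q 1 ?g (of_real q * \<zeta>)) / (of_real (1 - q ^ 2) * \<zeta>) = - of_real (1 / (1 - q ^ 2)) * Fourier q (Zop f) \<zeta>"
      if \<zeta>: "norm \<zeta> = q powi m" for \<zeta> m
      unfolding dot_eq[OF one_neq_zero Fourier_continues_inward_Zop[OF f_integrable f_circ int \<zeta>]] of_real_divide s_def[symmetric]
      using s nz_circle[OF \<zeta>] by (simp add: field_simps)
    note * = extend0_Fourier[OF int this]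
    show "\<forall>\<zeta>\<in>Gam_bar q. dL q ?g \<zeta> = - of_real (1 / (1 - q ^ 2)) * Fourier q (Zop f) \<zeta>"
      unfolding dL_def by (rule *(1))
    show "diff_dom q 1 (dL q) ?g"
      unfolding diff_dom_def dL_def by (intro conjI *(2) continuable_if[OF Fourier_continues_inward_star[OF f_integrable f_circ ints]])
  next
    assume int: "integrable (mu q) (Zop_star f)"
    have "(dot q 1 ?g (of_real (inverse q) * \<zeta>) - ?g \<zeta>) / (of_real (q powi (-2) - 1) * cnj \<zeta>) = of_real (1 / (1 - q ^ 2)) * Fourier q (Zop_star f) \<zeta>"
      if \<zeta>: "norm \<zeta> = q powi m" for \<zeta> m
      unfolding dot_eq[OF one_neq_zero Fourier_continues_inward_star[OF f_integrable f_circ int norm_q_mult(2)[OF \<zeta>]]]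
        iq of_real_divide sm s_def[symmetric] C_def[symmetric]
      using s C0 nz_circle[OF \<zeta>] by (simp add: field_simps)
    note * = extend0_Fourier[OF int this]
    show "\<forall>\<zeta>\<in>Gam_bar q. dL_bar q ?g \<zeta> = of_real (1 / (1 - q ^ 2)) * Fourier q (Zop_star f) \<zeta>"
      unfolding dL_bar_def by (rule *(1))
    show "diff_dom q 1 (dL_bar q) ?g"
      unfolding diff_dom_def dL_bar_def by (intro conjI *(2) continuable_if[OF Fourier_continues_inward_star[OF f_integrable f_circ int]])
  next
    let ?u = "Zop ((sigma_i q \<circ> theta q) f)"
    assume int: "integrable (mu q) ?u"
    have "(dot q (-1) ?g (of_real (inverse q) * \<zeta>) - ?g \<zeta>) / (of_real (q powi (-2) - 1) * \<zeta>) = - of_real (q ^ 4 / (1 - q ^ 2)) * Fourier q ?u \<zeta>"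
      if \<zeta>: "norm \<zeta> = q powi m" for \<zeta> m
    proof -
      \<comment> \<open>The derivative continues from \<zeta> / q, so q^3 becomes q^2 = q^(-2) q^4;
        the q^(-2) cancels against the denominator.\<close>
      have "of_real (q ^ 3) * (of_real (inverse q) * \<zeta>) = C * (of_real (q ^ 4) * \<zeta>)"
      proof -
        have "q ^ 3 * inverse q = q powi (-2) * q ^ 4" by (simp add: power_int_minus field_simps flip: power_Suc power_add)
        then have "complex_of_real (q ^ 3) * of_real (inverse q) = C * of_real (q ^ 4)" unfolding C_def by (metis of_real_mult)
        then show ?thesis by (simp only: mult.assoc[symmetric])
      qed
      then have "dot q (-1) ?g (of_real (inverse q) * \<zeta>) = ?g \<zeta> - C * (of_real (q ^ 4) * \<zeta>) * Fourier q ?u \<zeta>"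
        using dot_eq[OF _ Fourier_continues_outward_theta[OF int norm_q_mult(2)[OF \<zeta>]]] unfolding iq by simp
      note d = this
      show ?thesis
        unfolding d of_real_divide sm s_def[symmetric] C_def[symmetric]
        using s C0 nz_circle[OF \<zeta>] by (simp add: field_simps)
    qed
    note * = extend0_Fourier[OF int this]
    show "\<forall>\<zeta>\<in>Gam_bar q. dR q ?g \<zeta> = - of_real (q ^ 4 / (1 - q ^ 2)) * Fourier q ?u \<zeta>"
      unfolding dR_def by (rule *(1))
    show "diff_dom q (-1) (dR q) ?g"
      unfolding diff_dom_def dR_def by (intro conjI *(2) continuable_if[OF Fourier_continues_outward_theta[OF int]])
  next
    let ?u = "Zop_star ((sigma_i q \<circ> theta_inv q) f)"
    assume int: "integrable (mu q) ?u"
    have "(?g \<zeta> - dot q (-1) ?g (of_real q * \<zeta>)) / (of_real (1 - q ^ 2) * cnj \<zeta>) = of_real (q powi (-4) / (1 - q ^ 2)) * Fourier q ?u \<zeta>"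
      if \<zeta>: "norm \<zeta> = q powi m" for \<zeta> m
    proof -
      \<comment> \<open>The derivative continues from q \<zeta>, and the extra q turns q^(-5) into
        the q^(-4) of the last relation.\<close>
      have "of_real (q powi (-5)) * cnj (of_real q * \<zeta>) = of_real (q powi (-4)) * cnj \<zeta>"
      proof -
        have "q powi (-5) * q = q powi (-4)" using powi_add[of "-5" 1] by simp
        then have "complex_of_real (q powi (-5)) * of_real q = of_real (q powi (-4))" by (metis of_real_mult)
        then show ?thesis by (simp only: complex_cnj_mult complex_cnj_complex_of_real mult.assoc[symmetric])
      qed
      then have "dot q (-1) ?g (of_real q * \<zeta>) = ?g \<zeta> - of_real (q powi (-4)) * cnj \<zeta> * Fourier q ?u \<zeta>"
        using dot_eq[OF _ Fourier_continues_outward_theta_inv[OF int norm_q_mult(1)[OF \<zeta>]]] unfolding iq by simp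
      note d = this
      show ?thesis
        unfolding d of_real_divide s_def[symmetric] using s nz_circle[OF \<zeta>] by (simp add: field_simps)
    qed
    note * = extend0_Fourier[OF int this]
    show "\<forall>\<zeta>\<in>Gam_bar q. dR_bar q ?g \<zeta> = of_real (q powi (-4) / (1 - q ^ 2)) * Fourier q ?u \<zeta>"
      unfolding dR_bar_def by (rule *(1))
    show "diff_dom q (-1) (dR_bar q) ?g"
      unfolding diff_dom_def dR_bar_def by (intro conjI *(2) continuable_if[OF Fourier_continues_outward_theta_inv[OF int]])
  qed
qed

end
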